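(* Suppose that: (1a) $f$ is once and $g$ is twice continuously differentiable (and $\widetilde f(\cdot,\cdot;\xi)$ is once continuously differentiable for each sample $\xi$); (1b) for every $\mathbf{x}\in\mathbb{R}^{d_u}$ the set $\mathcal{Y}(\mathbf{x})=\{\mathbf{y}\in\mathbb{R}^{d_\ell}: A\mathbf{y}+B\mathbf{x}\le\mathbf{b}\}$ is compact; (1c) $g(\mathbf{x},\cdot)$ is $\mu_g$-strongly convex for every $\mathbf{x}\in\mathbb{R}^{d_u}$, with $\mu_g>0$; (3a) for every $\mathbf{x}\in\mathbb{R}^{d_u}$ there is $\mathbf{y}\in\mathbb{R}^{d_\ell}$ with $A\mathbf{y}+B\mathbf{x}<\mathbf{b}$; (3b) the active constraint matrix $\overline{A}(\mathbf{y}_q^*(\mathbf{x}))$ has full row rank for every $\mathbf{x}\in\mathbb{R}^{d_u}$. Then the functions $\overline{F}(\mathbf{x})=\mathbb{E}_{\mathbf{q}\sim\mathcal{Q}}[F_q(\mathbf{x})]$ and $\overline{F}(\mathbf{x},\xi)=\mathbb{E}_{\mathbf{q}\sim\mathcal{Q}}[F_q(\mathbf{x};\xi)]$ are differentiable at every $\mathbf{x}\in\mathbb{R}^{d_u}$, and $$\nabla\overline{F}(\mathbf{x})=\mathbb{E}_{\mathbf{q}\sim\mathcal{Q}}[\nabla F_q(\mathbf{x})],\qquad \nabla\overline{F}(\mathbf{x},\xi)=\mathbb{E}_{\mathbf{q}\sim\mathcal{Q}}[\nabla F_q(\mathbf{x};\xi)].$$ Further, for every $\mathbf{x}$ and with probability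 one over $\mathbf{q}\sim\mathcal{Q}$, the gradients are $$\nabla F_q(\mathbf{x})=\nabla_x f(\mathbf{x},\mathbf{y}_q^*(\mathbf{x}))+[\nabla\mathbf{y}_q^*(\mathbf{x})]^\top\nabla_y f(\mathbf{x},\mathbf{y}_q^*(\mathbf{x})),$$ $$\nabla F_q(\mathbf{x};\xi)=\nabla_x\widetilde f(\mathbf{x},\mathbf{y}_q^*(\mathbf{x});\xi)+[\nabla\mathbf{y}_q^*(\mathbf{x})]^\top\nabla_y\widetilde f(\mathbf{x},\mathbf{y}_q^*(\mathbf{x});\xi),$$ where $$\nabla\mathbf{y}_q^*(\mathbf{x})=\big[\nabla_{yy}^2g(\mathbf{x},\mathbf{y}_q^*(\mathbf{x}))\big]^{-1}\big[-\nabla_{xy}^2g(\mathbf{x},\mathbf{y}_q^*(\mathbf{x}))-\overline{A}^\top\nabla\overline{\boldsymbol\lambda}_q^*(\mathbf{x})\big],$$ $$\nabla\overline{\boldsymbol\lambda}_q^*(\mathbf{x})=-\Big[\overline{A}\big[\nabla_{yy}^2g(\mathbf{x},\mathbf{y}_q^*(\mathbf{x}))\big]^{-1}\overline{A}^\top\Big]^{-1}\Big[\overline{A}\big[\nabla_{yy}^2g(\mathbf{x},\mathbf{y}_q^*(\mathbf{x}))\big]^{-1}\nabla_{xy}^2g(\mathbf{x},\mathbf{y}_q^*(\mathbf{x}))-\overline{B}\Big],$$ with $\overline{A}=\overline{A}(\mathbf{y}_q^*(\mathbf{x}))$ and $\overline{B}=\overline{B}(\mathbf{y}_q^*(\ma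thbf{x}))$.
   Context: Data: $f(\mathbf{x},\mathbf{y})=\mathbb{E}_{\xi\sim\mathcal{D}_f}[\widetilde f(\mathbf{x},\mathbf{y};\xi)]$ with $f,g:\mathbb{R}^{d_u}\times\mathbb{R}^{d_\ell}\to\mathbb{R}$; $A\in\mathbb{R}^{k\times d_\ell}$, $B\in\mathbb{R}^{k\times d_u}$, $\mathbf{b}\in\mathbb{R}^k$. $\mathcal{Q}$ is a continuous distribution on $\mathbb{R}^{d_\ell}$ (absolutely continuous with respect to Lebesgue measure). For $\mathbf{q}\in\mathbb{R}^{d_\ell}$ put $g_q(\mathbf{x},\mathbf{y})=g(\mathbf{x},\mathbf{y})+\mathbf{q}^\top\mathbf{y}$ and $\mathbf{y}_q^*(\mathbf{x})=\arg\min\{g_q(\mathbf{x},\mathbf{y}): A\mathbf{y}+B\mathbf{x}\le\mathbf{b}\}$; $F_q(\mathbf{x})=f(\mathbf{x},\mathbf{y}_q^*(\mathbf{x}))$ and $F_q(\mathbf{x};\xi)=\widetilde f(\mathbf{x},\mathbf{y}_q^*(\mathbf{x});\xi)$. For feasible $\mathbf{y}$, $\overline{A}(\mathbf{y}),\overline{B}(\mathbf{y}),\overline{\mathbf{b}}(\mathbf{y})$ are the submatrices/subvector of $A,B,\mathbf{b}$ formed by the rows of the constraints $A\mathbf{y}\le\mathbf{b}-B\mathbf{x}$ that are active at $\mathbf{y}$, so $\overline{A}(\mathbf{y})\mathbf{y}=\overline{\mathbf{b}}(\mathbf{y})-\overline{B}(\mathbf{y})\mathbf{x}$. $\overline{\boldsymbol\lambda}_q^*(\mathbf{x})$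 is the vector of Lagrange multipliers of the problem defining $\mathbf{y}_q^*(\mathbf{x})$ corresponding to the constraints active at $\mathbf{y}_q^*(\mathbf{x})$. $\nabla\mathbf{y}_q^*(\mathbf{x})\in\mathbb{R}^{d_\ell\times d_u}$ and $\nabla\overline{\boldsymbol\lambda}_q^*(\mathbf{x})$ are Jacobians in $\mathbf{x}$; $\nabla^2_{xy}g\in\mathbb{R}^{d_\ell\times d_u}$ is the Jacobian in $\mathbf{x}$ of $\nabla_yg$. If no constraint is active the terms containing $\overline{A}$ are absent. *)

theory Defs
  imports "HOL-Probability.Probability"
begin

definition cont_diff :: "('a::real_normed_vector \<Rightarrow> 'b::real_normed_vector) \<Rightarrow> bool" where
  "cont_diff h \<longleftrightarrow>
     (\<exists>h' :: 'a \<Rightarrow> 'a \<Rightarrow>\<^sub>L 'b.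
        (\<forall>z. (h has_derivative blinfun_apply (h' z)) (at z)) \<and> continuous_on UNIV h')"

definition cont_diff2 :: "('a::real_normed_vector \<Rightarrow> 'b::real_normed_vector) \<Rightarrow> bool" where
  "cont_diff2 h \<longleftrightarrow>
     (\<exists>h' :: 'a \<Rightarrow> 'a \<Rightarrow>\<^sub>L 'b.
        (\<forall>z. (h has_derivative blinfun_apply (h' z)) (at z)) \<and> cont_diff h')"

text \<open>Meaningful only where \<open>h\<close> is differentiable; statements about \<open>gradient h x\<close>
  therefore carry differentiability separately.\<close>

definition gradient :: "('a::real_inner \<Rightarrow> real) \<Rightarrow> 'a \<Rightarrow> 'a" where
  "gradient h x = (THE D. GDERIV h x :> D)"

lemma gradient_eqI:
  assumes "GDERIV h x :> D"
  shows "gradient h x = D"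
  unfolding gradient_def
proof (rule the_equality)
  show "GDERIV h x :> D" by (rule assms)
next
  fix E assume "GDERIV h x :> E"
  with assms have "(\<lambda>v. v \<bullet> E) = (\<lambda>v. v \<bullet> D)"
    unfolding gderiv_def by (rule has_derivative_unique[rotated])
  then show "E = D"
    by (metis inner_commute vector_eq_ldot)
qed

definition strongly_convex :: "real \<Rightarrow> ('a::real_normed_vector \<Rightarrow> real) \<Rightarrow> bool" where
  "strongly_convex \<mu> h \<longleftrightarrow>
     (\<forall>y z. \<forall>t\<in>{0..1}.
        h (t *\<^sub>R y + (1 - t) *\<^sub>R z)
          \<le> t * h y + (1 - t) * h z - \<mu> / 2 * t * (1 - t) * (norm (y - z))\<^sup>2)"

definition grad_x :: "('a::real_inner \<times> 'b::real_inner \<Rightarrow> real) \<Rightarrow> 'a \<Rightarrow> 'b \<Rightarrow> 'a" where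
  "grad_x h x y = gradient (\<lambda>x'. h (x', y)) x"

definition grad_y :: "('a::real_inner \<times> 'b::real_inner \<Rightarrow> real) \<Rightarrow> 'a \<Rightarrow> 'b \<Rightarrow> 'b" where
  "grad_y h x y = gradient (\<lambda>y'. h (x, y')) y"

definition hess_yy :: "((real^'u) \<times> (real^'l) \<Rightarrow> real) \<Rightarrow> real^'u \<Rightarrow> real^'l \<Rightarrow> real^'l^'l" where
  "hess_yy h x y = jacobian (\<lambda>y'. grad_y h x y') (at y)"

definition hess_xy :: "((real^'u) \<times> (real^'l) \<Rightarrow> real) \<Rightarrow> real^'u \<Rightarrow> real^'l \<Rightarrow> real^'u^'l" where
  "hess_xy h x y = jacobian (\<lambda>x'. grad_y h x' y) (at x)"

text \<open>The number of active rows depends on the point, so the submatrix of the rows in \<open>I\<close> is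
  represented in the ambient index type with its remaining rows set to zero. Products and
  transposes of such padded matrices are the padded products and transposes, the rank is that of
  the submatrix, and for \<open>I = {}\<close> everything vanishes.\<close>

definition row_part :: "'k set \<Rightarrow> ('a::zero)^'n^'k \<Rightarrow> 'a^'n^'k" where
  "row_part I M = (\<chi> i. if i \<in> I then M $ i else 0)"

definition vec_part :: "'k set \<Rightarrow> ('a::zero)^'k \<Rightarrow> 'a^'k" where
  "vec_part I v = (\<chi> i. if i \<in> I then v $ i else 0)"

text \<open>The inverse of an \<open>I \<times> I\<close> matrix, again padded with zeros; \<open>row_part I (mat 1)\<close> is the
  padded \<open>I \<times> I\<close> identity.\<close>

definition block_inv :: "'k set \<Rightarrow> real^'k^'k \<Rightarrow> real^'k^'k" where
  "block_inv I M =
     (THE N. (\<forall>i j. i \<notin> I \<or> j \<notin> I \<longrightarrow> N $ i $ j = 0) \<and>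
             M ** N = row_part I (mat 1) \<and> N ** M = row_part I (mat 1))"

definition feasible :: "real^'l^'k \<Rightarrow> real^'u^'k \<Rightarrow> real^'k \<Rightarrow> real^'u \<Rightarrow> (real^'l) set" where
  "feasible A B b x = {y. \<forall>i. (A *v y + B *v x) $ i \<le> b $ i}"

definition perturb ::
    "((real^'u) \<times> (real^'l) \<Rightarrow> real) \<Rightarrow> real^'l \<Rightarrow> (real^'u) \<times> (real^'l) \<Rightarrow> real" where
  "perturb g q = (\<lambda>(x, y). g (x, y) + q \<bullet> y)"

definition ystar :: "((real^'u) \<times> (real^'l) \<Rightarrow> real) \<Rightarrow> real^'l^'k \<Rightarrow> real^'u^'k \<Rightarrow> real^'k \<Rightarrow>
    real^'l \<Rightarrow> real^'u \<Rightarrow> real^'l" where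
  "ystar g A B b q x = arg_min_on (\<lambda>y. perturb g q (x, y)) (feasible A B b x)"

text \<open>The implicit function \<open>F\<^sub>q\<close>, for \<open>h\<close> being either the upper-level objective or one of its samples.\<close>

definition implicit_obj :: "((real^'u) \<times> (real^'l) \<Rightarrow> real) \<Rightarrow>
    ((real^'u) \<times> (real^'l) \<Rightarrow> real) \<Rightarrow> real^'l^'k \<Rightarrow> real^'u^'k \<Rightarrow> real^'k \<Rightarrow>
    real^'l \<Rightarrow> real^'u \<Rightarrow> real" where
  "implicit_obj h g A B b q x = h (x, ystar g A B b q x)"

definition active :: "real^'l^'k \<Rightarrow> real^'u^'k \<Rightarrow> real^'k \<Rightarrow> real^'u \<Rightarrow> real^'l \<Rightarrow> 'k set" where
  "active A B b x y = {i. (A *v y + B *v x) $ i = b $ i}"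

definition lagrangian :: "((real^'u) \<times> (real^'l) \<Rightarrow> real) \<Rightarrow> real^'l^'k \<Rightarrow> real^'u^'k \<Rightarrow> real^'k \<Rightarrow>
    real^'l \<Rightarrow> real^'u \<Rightarrow> real^'k \<Rightarrow> real^'l \<Rightarrow> real" where
  "lagrangian g A B b q x lam y = perturb g q (x, y) + lam \<bullet> (A *v y + B *v x - b)"

definition lagrange_multiplier :: "((real^'u) \<times> (real^'l) \<Rightarrow> real) \<Rightarrow> real^'l^'k \<Rightarrow> real^'u^'k \<Rightarrow>
    real^'k \<Rightarrow> real^'l \<Rightarrow> real^'u \<Rightarrow> real^'k \<Rightarrow> bool" where
  "lagrange_multiplier g A B b q x lam \<longleftrightarrow>
     (let y = ystar g A B b q x in
        GDERIV (lagrangian g A B b q x lam) y :> 0 \<and>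
        (\<forall>i. lam $ i \<ge> 0) \<and>
        (\<forall>i. lam $ i * (A *v y + B *v x - b) $ i = 0))"

text \<open>The multipliers of the constraints active at the solution, padded with zeros. The active set
  is taken at the current \<open>x\<close>, so near a point the padded vector has a fixed length even where the
  active set changes, and its Jacobian is defined.\<close>

definition lambda_bar :: "((real^'u) \<times> (real^'l) \<Rightarrow> real) \<Rightarrow> real^'l^'k \<Rightarrow> real^'u^'k \<Rightarrow> real^'k \<Rightarrow>
    real^'l \<Rightarrow> real^'u \<Rightarrow> real^'k" where
  "lambda_bar g A B b q x =
     vec_part (active A B b x (ystar g A B b q x)) (THE lam. lagrange_multiplier g A B b q x lam)"

end

theory Submission
  imports Defs
begin

text \<open>
  For a fixed perturbation \<open>q\<close> the solution \<open>ystar g A B b q\<close> of the lower-level problem is only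
  piecewise smooth in \<open>x\<close>: it can have kinks where an active constraint carries a zero multiplier. The
  expectation over \<open>q\<close> is nevertheless differentiable at every \<open>x\<close>, for two reasons.

  First, at a given \<open>x\<close> almost no \<open>q\<close> produces a kink. Stationarity expresses \<open>q\<close> as a function of
  the solution and its multipliers. With active set \<open>J\<close> these have as many degrees of freedom as \<open>q\<close>
  itself, and one degree less if a multiplier vanishes. So the exceptional perturbations lie in
  finitely many differentiable images of hyperplanes, which are negligible
  (\<open>strict_complementarity_lborel\<close>). Under strict complementarity the active set is constant near
  \<open>x\<close>, the optimality system is a system of equations, and solving its linearization by block
  elimination yields the stated Jacobians (\<open>sol_lambda_bar_derivative\<close>). The gradient of the implicit
  objective is then a matter of the chain rule.

  Second, the solution is Lipschitz in \<open>x\<close> near every point, and neither the neighbourhood nor the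
  constant depends on \<open>q\<close> (\<open>sol_lipschitz\<close>). Near \<open>x\<close> the active set can only shrink, which allows the
  two variational inequalities to be tested against each other in a way that eliminates \<open>q\<close>; the
  resulting bound involves strong convexity, a Lipschitz constant of the gradient of \<open>g\<close> on a compact
  set, and right inverses of the finitely many active blocks. It holds from each point to its
  neighbours and extends along segments.

  Dominated convergence then moves the derivative under the expectation (\<open>gradient_of_integral\<close>).
  Its measurability requirement is met because differentiability at \<open>x\<close> of a function depending
  continuously on \<open>q\<close> is a Borel condition on \<open>q\<close>, and the gradient has a fixed default value where
  that condition fails (\<open>gradient_borel_measurable\<close>).
\<close>

section \<open>Strong convexity, smoothness and Lipschitz bounds\<close>

lemma strongly_convex_lower_bound:
  assumes conv: "strongly_convex \<mu> h" and der: "GDERIV h y :> d"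
  shows "h y + (z - y) \<bullet> d + \<mu> / 2 * (norm (z - y))\<^sup>2 \<le> h z"
proof -
  define u where "u t = h (y + t *\<^sub>R (z - y))" for t
  have "((\<lambda>t. y + t *\<^sub>R (z - y)) has_derivative (\<lambda>t. t *\<^sub>R (z - y))) (at 0)"
    by (auto intro!: derivative_eq_intros)
  moreover have "(h has_derivative (\<lambda>v. v \<bullet> d)) (at (y + 0 *\<^sub>R (z - y)))"
    using der by (simp add: gderiv_def)
  ultimately have "(u has_derivative (\<lambda>t. t *\<^sub>R (z - y) \<bullet> d)) (at 0)"
    unfolding u_def by (rule has_derivative_compose)
  then have "(u has_real_derivative ((z - y) \<bullet> d)) (at 0)"
    unfolding has_field_derivative_def
    by (auto elim!: has_derivative_eq_rhs simp: fun_eq_iff)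
  then have lim: "((\<lambda>t. (u t - u 0) / t) \<longlongrightarrow> (z - y) \<bullet> d) (at_right 0)"
    by (auto simp: has_field_derivative_iff intro: filterlim_mono at_le)
  have upper: "((\<lambda>t. h z - h y - \<mu> / 2 * (1 - t) * (norm (z - y))\<^sup>2) \<longlongrightarrow>
      h z - h y - \<mu> / 2 * (1 - 0) * (norm (z - y))\<^sup>2) (at_right 0)"
    by (intro tendsto_intros)
  have "eventually (\<lambda>t::real. 0 < t \<and> t < 1) (at_right 0)"
    by (auto simp: eventually_at_right_field intro: exI[of _ 1])
  then have "eventually (\<lambda>t. (u t - u 0) / t
      \<le> h z - h y - \<mu> / 2 * (1 - t) * (norm (z - y))\<^sup>2) (at_right 0)"
  proof eventually_elim
    case (elim t)
    have "h (t *\<^sub>R z + (1 - t) *\<^sub>R y)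
        \<le> t * h z + (1 - t) * h y - \<mu> / 2 * t * (1 - t) * (norm (z - y))\<^sup>2"
      using conv elim unfolding strongly_convex_def by auto
    moreover have "t *\<^sub>R z + (1 - t) *\<^sub>R y = y + t *\<^sub>R (z - y)"
      by (simp add: algebra_simps)
    ultimately have "u t - u 0 \<le> t * (h z - h y - \<mu> / 2 * (1 - t) * (norm (z - y))\<^sup>2)"
      by (simp add: u_def algebra_simps)
    then show ?case using elim by (simp add: divide_le_eq mult.commute)
  qed
  then have "(z - y) \<bullet> d \<le> h z - h y - \<mu> / 2 * (1 - 0) * (norm (z - y))\<^sup>2"
    by (rule tendsto_le[OF trivial_limit_at_right_real upper lim])
  then show ?thesis by simp
qed

lemma strongly_convex_gradient_monotone:
  assumes "strongly_convex \<mu> h" "GDERIV h y :> d" "GDERIV h z :> e"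
  shows "\<mu> * (norm (z - y))\<^sup>2 \<le> (z - y) \<bullet> (e - d)"
  using strongly_convex_lower_bound[OF assms(1,2), of z]
    strongly_convex_lower_bound[OF assms(1,3), of y]
  by (simp add: norm_minus_commute inner_diff_right inner_diff_left)

lemma cont_diff_imp_has_derivative:
  assumes "cont_diff h"
  obtains h' where "\<And>z. (h has_derivative blinfun_apply (h' z)) (at z)" "continuous_on UNIV h'"
  using assms unfolding cont_diff_def by auto

lemma cont_diff_imp_continuous_on:
  assumes "cont_diff h"
  shows "continuous_on S h"
  using assms unfolding cont_diff_def
  by (auto intro!: continuous_at_imp_continuous_on dest: has_derivative_continuous)

lemma cont_diff_lipschitz_on_compact:
  assumes h: "cont_diff h" and S: "compact S" "convex S"
  obtains L where "L \<ge> 0" "\<And>u v. u \<in> S \<Longrightarrow> v \<in> S \<Longrightarrow> norm (h u - h v) \<le> L * norm (u - v)"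
proof -
  obtain h' where h': "\<And>z. (h has_derivative blinfun_apply (h' z)) (at z)"
    and cont: "continuous_on UNIV h'"
    using cont_diff_imp_has_derivative[OF h] by blast
  have "bounded (h' ` S)"
    using S(1) cont by (intro compact_imp_bounded compact_continuous_image)
      (auto intro: continuous_on_subset)
  then obtain L where L: "L > 0" "\<And>z. z \<in> S \<Longrightarrow> norm (h' z) \<le> L"
    unfolding bounded_pos by auto
  have "norm (h u - h v) \<le> L * norm (u - v)" if "u \<in> S" "v \<in> S" for u v
    by (rule differentiable_bound[OF S(2), where f' = "\<lambda>z. blinfun_apply (h' z)"])
      (use that L in \<open>auto simp: norm_blinfun.rep_eq[symmetric] intro: has_derivative_at_withinI h'\<close>)
  with L(1) show thesis by (intro that[of L]) auto
qed

text \<open>A Lipschitz bound that holds from each point of a segment to its neighbours, with one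
  constant but without any control on the size of the neighbourhoods, chains up to the whole
  segment.\<close>

lemma lipschitz_along_segment:
  fixes \<phi> :: "'a::real_normed_vector \<Rightarrow> 'b::real_normed_vector"
  assumes local: "\<And>p. p \<in> closed_segment u v \<Longrightarrow>
    eventually (\<lambda>p'. norm (\<phi> p' - \<phi> p) \<le> C * norm (p' - p)) (nhds p)"
  shows "norm (\<phi> v - \<phi> u) \<le> C * norm (v - u)"
proof -
  define p where "p t = u + t *\<^sub>R (v - u)" for t :: real
  have dist_p: "norm (p s - p t) = \<bar>s - t\<bar> * norm (v - u)" for s t
    by (simp add: p_def flip: scaleR_left_diff_distrib)
  have "norm (\<phi> (p 1) - \<phi> (p 0)) \<le> C * ((1 - 0) * norm (v - u))"
  proof (rule Bolzano[where P = "\<lambda>s t. norm (\<phi> (p t) - \<phi> (p s)) \<le> C * ((t - s) * norm (v - u))"])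
    fix a b c :: real
    assume trans: "norm (\<phi> (p b) - \<phi> (p a)) \<le> C * ((b - a) * norm (v - u))"
      "norm (\<phi> (p c) - \<phi> (p b)) \<le> C * ((c - b) * norm (v - u))"
    have "norm (\<phi> (p c) - \<phi> (p a)) \<le> norm (\<phi> (p c) - \<phi> (p b)) + norm (\<phi> (p b) - \<phi> (p a))"
      using norm_triangle_ineq[of "\<phi> (p c) - \<phi> (p b)" "\<phi> (p b) - \<phi> (p a)"] by simp
    with trans show "norm (\<phi> (p c) - \<phi> (p a)) \<le> C * ((c - a) * norm (v - u))"
      by (simp add: algebra_simps)
  next
    fix t :: real assume t: "0 \<le> t" "t \<le> 1"
    have "p t \<in> closed_segment u v"
      using t by (auto simp: p_def in_segment algebra_simps intro!: exI[of _ t])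
    moreover have "(p \<longlongrightarrow> p t) (nhds t)"
      unfolding p_def by (intro tendsto_intros filterlim_ident)
    ultimately have "eventually (\<lambda>s. norm (\<phi> (p s) - \<phi> (p t)) \<le> C * norm (p s - p t)) (nhds t)"
      using assms by (intro eventually_compose_filterlim[of _ "nhds (p t)" p]) auto
    then obtain d where d: "d > 0"
      "\<And>s. \<bar>s - t\<bar> < d \<Longrightarrow> norm (\<phi> (p s) - \<phi> (p t)) \<le> C * (\<bar>s - t\<bar> * norm (v - u))"
      unfolding eventually_nhds_metric dist_p by (auto simp: dist_real_def)
    show "\<exists>d>0. \<forall>a c. a \<le> t \<and> t \<le> c \<and> c - a < d \<longrightarrow>
        norm (\<phi> (p c) - \<phi> (p a)) \<le> C * ((c - a) * norm (v - u))"
    proof (intro exI[of _ d] conjI allI impI d(1))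
      fix a c assume ac: "a \<le> t \<and> t \<le> c \<and> c - a < d"
      have "norm (\<phi> (p c) - \<phi> (p a)) \<le> norm (\<phi> (p c) - \<phi> (p t)) + norm (\<phi> (p a) - \<phi> (p t))"
        using norm_triangle_ineq4[of "\<phi> (p c) - \<phi> (p t)" "\<phi> (p a) - \<phi> (p t)"] by simp
      also have "\<dots> \<le> C * (\<bar>c - t\<bar> * norm (v - u)) + C * (\<bar>a - t\<bar> * norm (v - u))"
        using ac by (intro add_mono d(2)) auto
      also have "\<dots> = C * ((c - a) * norm (v - u))"
        using ac by (simp add: algebra_simps)
      finally show "norm (\<phi> (p c) - \<phi> (p a)) \<le> C * ((c - a) * norm (v - u))" .
    qed
  qed simp
  then show ?thesis by (simp add: p_def)
qed

lemma has_derivative_eventually_eq: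
  assumes "(f has_derivative f') (at x)" "eventually (\<lambda>x'. f x' = h x') (nhds x)"
    and "\<And>v. f' v = h' v"
  shows "(h has_derivative h') (at x)"
proof -
  have "f x = h x" using assms(2) by (rule eventually_nhds_x_imp_x)
  moreover have "eventually (\<lambda>x'. f x' = h x') (at x)"
    unfolding eventually_at_filter by (rule eventually_mono[OF assms(2)]) simp
  ultimately have "(h has_derivative f') (at x)"
    using has_derivative_transform_eventually[OF assms(1)] by simp
  moreover have "f' = h'" using assms(3) by (rule ext)
  ultimately show ?thesis by simp
qed

subsection \<open>The partial gradient in the lower-level variable\<close>

lemma cont_diff_linear_image:
  assumes h: "cont_diff h" and T: "bounded_linear T"
  shows "cont_diff (\<lambda>z. T (h z))"
proof -
  obtain h' where h': "\<And>z. (h has_derivative blinfun_apply (h' z)) (at z)" "continuous_on UNIV h'"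
    using cont_diff_imp_has_derivative[OF h] by blast
  have "blinfun_apply (Blinfun T o\<^sub>L h' z) = (\<lambda>v. T (h' z v))" for z
    using T by (auto simp: bounded_linear_Blinfun_apply fun_eq_iff)
  then have "((\<lambda>z. T (h z)) has_derivative blinfun_apply (Blinfun T o\<^sub>L h' z)) (at z)" for z
    using bounded_linear.has_derivative[OF T h'(1)] by simp
  moreover have "continuous_on UNIV (\<lambda>z. Blinfun T o\<^sub>L h' z)"
    by (intro continuous_intros h'(2))
  ultimately show ?thesis unfolding cont_diff_def
    by (intro exI[of _ "\<lambda>z. Blinfun T o\<^sub>L h' z"]) auto
qed

text \<open>The coordinate formula for the partial gradient expresses it linearly in the derivative of \<open>h\<close>;
  this is how \<open>grad_y g\<close> inherits one order of smoothness from \<open>g\<close>.\<close>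

lemma partial_gradients:
  fixes h :: "'a::euclidean_space \<times> 'b::euclidean_space \<Rightarrow> real"
  assumes der: "(h has_derivative h') (at (x, y))"
  shows gderiv_grad_x: "GDERIV (\<lambda>x'. h (x', y)) x :> grad_x h x y"
    and gderiv_grad_y: "GDERIV (\<lambda>y'. h (x, y')) y :> grad_y h x y"
    and derivative_eq_partial_gradients: "h' (v, w) = v \<bullet> grad_x h x y + w \<bullet> grad_y h x y"
    and grad_y_eq_sum: "grad_y h x y = (\<Sum>i\<in>Basis. h' (0, i) *\<^sub>R i)"
proof -
  interpret bounded_linear h' by (rule has_derivative_bounded_linear[OF der])
  define dx where "dx = (\<Sum>i\<in>Basis. h' (i, 0) *\<^sub>R i)"
  define dy where "dy = (\<Sum>i\<in>Basis. h' (0, i) *\<^sub>R i)"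
  have x_part: "h' (v, 0) = v \<bullet> dx" for v
  proof -
    have "h' (v, 0) = h' (\<Sum>i\<in>Basis. (v \<bullet> i) *\<^sub>R (i, 0))"
      by (rule arg_cong[of _ _ h'])
        (simp add: prod_eq_iff fst_sum snd_sum euclidean_representation)
    also have "\<dots> = v \<bullet> dx" by (simp only: sum scaleR) (simp add: dx_def inner_sum_right mult.commute)
    finally show ?thesis .
  qed
  have y_part: "h' (0, w) = w \<bullet> dy" for w
  proof -
    have "h' (0, w) = h' (\<Sum>i\<in>Basis. (w \<bullet> i) *\<^sub>R (0, i))"
      by (rule arg_cong[of _ _ h'])
        (simp add: prod_eq_iff fst_sum snd_sum euclidean_representation)
    also have "\<dots> = w \<bullet> dy" by (simp only: sum scaleR) (simp add: dy_def inner_sum_right mult.commute)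
    finally show ?thesis .
  qed
  have "((\<lambda>x'. h (x', y)) has_derivative (\<lambda>v. h' (v, 0))) (at x)"
    by (rule has_derivative_compose[where g = h and f = "\<lambda>x'. (x', y)"])
      (auto intro!: derivative_eq_intros der)
  then have gx: "GDERIV (\<lambda>x'. h (x', y)) x :> dx" by (simp add: gderiv_def x_part)
  have "((\<lambda>y'. h (x, y')) has_derivative (\<lambda>w. h' (0, w))) (at y)"
    by (rule has_derivative_compose[where g = h and f = "\<lambda>y'. (x, y')"])
      (auto intro!: derivative_eq_intros der)
  then have gy: "GDERIV (\<lambda>y'. h (x, y')) y :> dy" by (simp add: gderiv_def y_part)
  have ex: "grad_x h x y = dx" unfolding grad_x_def by (rule gradient_eqI[OF gx])
  have ey: "grad_y h x y = dy" unfolding grad_y_def by (rule gradient_eqI[OF gy])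
  show "GDERIV (\<lambda>x'. h (x', y)) x :> grad_x h x y" using gx ex by simp
  show "GDERIV (\<lambda>y'. h (x, y')) y :> grad_y h x y" using gy ey by simp
  show "grad_y h x y = (\<Sum>i\<in>Basis. h' (0, i) *\<^sub>R i)" using ey dy_def by simp
  have "h' (v, w) = h' (v, 0) + h' (0, w)" using add[of "(v, 0)" "(0, w)"] by simp
  then show "h' (v, w) = v \<bullet> grad_x h x y + w \<bullet> grad_y h x y" by (simp add: x_part y_part ex ey)
qed

lemma cont_diff_grad_y:
  fixes h :: "'a::euclidean_space \<times> 'b::euclidean_space \<Rightarrow> real"
  assumes "cont_diff2 h"
  shows "cont_diff (\<lambda>z. grad_y h (fst z) (snd z))"
proof -
  obtain h' where h': "\<And>z. (h has_derivative blinfun_apply (h' z)) (at z)" "cont_diff h'"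
    using assms unfolding cont_diff2_def by auto
  have "grad_y h (fst z) (snd z) = (\<Sum>i\<in>Basis. h' z (0, i) *\<^sub>R i)" for z
    using grad_y_eq_sum[of h "blinfun_apply (h' z)" "fst z" "snd z"] h'(1)[of z] by simp
  moreover have "cont_diff (\<lambda>z. \<Sum>i\<in>Basis. h' z (0, i) *\<^sub>R (i::'b))"
    by (intro cont_diff_linear_image[OF h'(2)] bounded_linear_intros)
  ultimately show ?thesis by simp
qed

lemma cont_diff2_imp_cont_diff:
  assumes "cont_diff2 h"
  shows "cont_diff h"
proof -
  obtain h' where h': "\<And>z. (h has_derivative blinfun_apply (h' z)) (at z)" "cont_diff h'"
    using assms unfolding cont_diff2_def by auto
  then show ?thesis
    unfolding cont_diff_def[of h]
    by (intro exI[of _ h'] conjI allI cont_diff_imp_continuous_on)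
qed

lemma jacobian_eqI:
  fixes M :: "real^'n^'m"
  assumes "(h has_derivative (\<lambda>v. M *v v)) (at z)"
  shows "jacobian h (at z) = M"
  unfolding jacobian_def frechet_derivative_at[OF assms, symmetric]
  by (simp add: matrix_def matrix_vector_mult_basis column_def vec_eq_iff)

section \<open>Padded submatrices\<close>

lemma row_part_mult_vec: "row_part I M *v v = vec_part I (M *v v)"
  by (simp add: vec_eq_iff row_part_def vec_part_def matrix_vector_mult_def)

lemma vec_part_component [simp]: "vec_part I v $ i = (if i \<in> I then v $ i else 0)"
  by (simp add: vec_part_def)

lemma row_part_mat_mult_vec: "row_part I (mat 1 :: real^'k^'k) *v v = vec_part I v"
  by (simp add: row_part_mult_vec)

lemma transpose_row_part_mult_vec:
  "transpose (row_part I M) *v v = transpose M *v vec_part I (v :: real^'k)"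
  by (auto simp: vec_eq_iff row_part_def matrix_vector_mult_def transpose_def intro!: sum.cong)

text \<open>Full row rank enters the argument through a right inverse of the active block. It exists
  because the range of the padded block lies in the coordinate subspace of \<open>I\<close>, and equal
  dimensions force the two to coincide.\<close>

lemma full_row_rank_right_inverse:
  fixes A :: "real^'l^'k"
  assumes "rank (row_part I A) = card I"
  obtains P :: "real^'k^'l" where "row_part I A ** P = row_part I (mat 1)"
proof -
  let ?R = "range (\<lambda>y. row_part I A *v y)" and ?S = "{v :: real^'k. \<forall>i. i \<notin> I \<longrightarrow> v $ i = 0}"
  have "?R = ?S"
  proof (rule subspace_dim_equal)
    show "subspace ?R"
      using matrix_vector_mul_linear[of "row_part I A"] linear_subspace_image subspace_UNIV by blast
    show "subspace ?S" by (auto simp: subspace_def)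
    show "?R \<subseteq> ?S" by (auto simp: row_part_mult_vec)
    show "dim ?S \<le> dim ?R"
      using assms dim_substandard_cart[of I, where ?'a = real]
      by (simp add: rank_dim_range dim_vec_eq)
  qed
  moreover have "vec_part I (axis i 1) \<in> ?S" for i by simp
  ultimately have "\<forall>i. \<exists>y. vec_part I (axis i 1) = row_part I A *v y" by blast
  then obtain p where p: "\<And>i. row_part I A *v p i = vec_part I (axis i 1)" by metis
  define P :: "real^'k^'l" where "P = (\<chi> j i. p i $ j)"
  have "P *v axis i 1 = p i" for i
    by (simp add: matrix_vector_mult_basis column_def P_def vec_eq_iff)
  then have "row_part I A ** P *v axis i 1 = row_part I (mat 1) *v axis i 1" for i
    by (simp add: matrix_vector_mul_assoc[symmetric] p row_part_mat_mult_vec)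
  then have "column i (row_part I A ** P) = column i (row_part I (mat 1))" for i
    by (simp add: matrix_vector_mult_basis)
  then have "row_part I A ** P = row_part I (mat 1)"
    by (simp add: column_def vec_eq_iff)
  then show thesis by (rule that)
qed

lemma row_part_mat_mult: "row_part I (mat 1) ** M = row_part I (M :: real^'n^'k)"
  unfolding matrix_eq
  by (intro allI)
    (simp only: matrix_vector_mul_assoc[symmetric] row_part_mult_vec matrix_vector_mul_lid)

lemma matrix_mult_add_diff_distribs:
  fixes M N :: "real^'n^'m"
  shows "(M + N) ** K = M ** K + N ** (K :: real^'k^'n)"
    and "(M - N) ** K = M ** K - N ** K"
    and "K' ** (M - N) = K' ** M - K' ** (N :: real^'n^'m)"
  by (simp_all add: vec_eq_iff matrix_matrix_mult_def algebra_simps sum.distrib sum_subtractf)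

lemma transpose_row_part_mat: "transpose (row_part I (mat 1)) = row_part I (mat 1 :: real^'k^'k)"
  by (auto simp: vec_eq_iff transpose_def row_part_def mat_def)

lemma row_part_idem [simp]: "row_part I (row_part I M) = row_part I M"
  by (simp add: vec_eq_iff row_part_def)

lemma matrix_inv_mult:
  fixes H :: "real^'n^'n"
  assumes "\<And>v. H *v v = 0 \<Longrightarrow> v = 0"
  shows "H ** matrix_inv H = mat 1" "matrix_inv H ** H = mat 1"
proof -
  obtain K where K: "K ** H = mat 1" using assms matrix_left_invertible_ker[of H] by auto
  have "H ** K = mat 1 \<and> K ** H = mat 1"
    by (rule conjI[OF matrix_left_right_inverse[THEN iffD1, OF K] K])
  then have "H ** matrix_inv H = mat 1 \<and> matrix_inv H ** H = mat 1"
    unfolding matrix_inv_def by (rule someI)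
  then show "H ** matrix_inv H = mat 1" "matrix_inv H ** H = mat 1" by auto
qed

text \<open>Adding ones on the diagonal outside \<open>I\<close> makes an injective \<open>I \<times> I\<close> block an invertible
  matrix of full size; cutting its inverse back to \<open>I \<times> I\<close> inverts the block.\<close>

lemma block_inv_mult:
  fixes I :: "'k::finite set" and M :: "real^'k^'k"
  defines "E \<equiv> row_part I (mat 1)"
  assumes EM: "E ** M = M" and ME: "M ** E = M"
    and inj: "\<And>v. M *v v = 0 \<Longrightarrow> vec_part I v = 0"
  shows "block_inv I M ** M = E"
proof -
  define D :: "real^'k^'k" where "D = mat 1 - E"
  have EE: "E ** E = E" by (simp add: E_def row_part_mat_mult)
  have ED: "E ** D = 0" and DE: "D ** E = 0"
    by (simp_all add: D_def matrix_mult_add_diff_distribs EE)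
  have Ev: "E *v v = vec_part I v" for v by (simp add: E_def row_part_mat_mult_vec)
  have "v = 0" if "(M + D) *v v = 0" for v
  proof -
    have "M *v v = E *v ((M + D) *v v)"
      by (simp only: matrix_vector_mul_assoc matrix_add_ldistrib EM ED add_0_right)
    with that have "M *v v = 0" by (simp only: matrix_vector_mult_0_right)
    then have "vec_part I v = 0" by (rule inj)
    moreover have "v - vec_part I v = 0"
      using that \<open>M *v v = 0\<close>
      by (simp add: D_def matrix_vector_mult_add_rdistrib matrix_vector_mult_diff_rdistrib Ev)
    ultimately show "v = 0" by simp
  qed
  then have "\<exists>K. K ** (M + D) = mat 1"
    by (intro matrix_left_invertible_ker[THEN iffD2]) auto
  then obtain K where K: "K ** (M + D) = mat 1" ..
  then have K': "(M + D) ** K = mat 1"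
    by (rule matrix_left_right_inverse[THEN iffD1])
  have comm: "E ** (M + D) = M" "(M + D) ** E = M"
    by (simp_all only: matrix_add_ldistrib matrix_mult_add_diff_distribs EM ME ED DE add_0_right)
  have KE: "K ** E = E ** K"
  proof -
    have "K ** E = K ** (E ** (M + D)) ** K"
      by (simp only: matrix_mul_assoc[symmetric] K' matrix_mul_rid)
    also have "\<dots> = (K ** (M + D)) ** (E ** K)"
      by (simp only: comm matrix_mul_assoc[symmetric]) (simp only: comm matrix_mul_assoc)
    finally show ?thesis by (simp add: K)
  qed
  define N where "N = K ** E"
  have NM: "N ** M = E"
  proof -
    have "N ** M = K ** (E ** M)" by (simp only: N_def matrix_mul_assoc)
    also have "\<dots> = K ** ((M + D) ** E)" by (simp only: EM comm)
    also have "\<dots> = (K ** (M + D)) ** E" by (simp only: matrix_mul_assoc)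
    finally show ?thesis by (simp add: K)
  qed
  have MN: "M ** N = E"
  proof -
    have "M ** N = (M ** E) ** K" by (simp only: N_def KE matrix_mul_assoc)
    also have "\<dots> = (E ** (M + D)) ** K" by (simp only: ME comm)
    also have "\<dots> = E ** ((M + D) ** K)" by (simp only: matrix_mul_assoc)
    finally show ?thesis by (simp add: K')
  qed
  have NE: "N ** E = N" by (simp only: N_def matrix_mul_assoc[symmetric] EE)
  have EN: "E ** N = N" by (simp only: N_def KE matrix_mul_assoc EE)
  have TE: "transpose E = E" by (simp add: E_def transpose_row_part_mat)
  have supp: "N $ i $ j = 0" if "i \<notin> I \<or> j \<notin> I" for i j
  proof -
    have "row_part I N = N" using EN by (simp add: E_def row_part_mat_mult)
    moreover have "row_part I (transpose N) = transpose N"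
      using arg_cong[OF NE, of transpose] TE
      by (simp add: matrix_transpose_mul E_def row_part_mat_mult)
    ultimately have "row_part I N $ i $ j = N $ i $ j"
        "row_part I (transpose N) $ j $ i = N $ i $ j"
      by (simp_all add: transpose_def)
    with that show ?thesis by (auto simp: row_part_def)
  qed
  have unique: "N' = N" if N': "\<And>i j. i \<notin> I \<or> j \<notin> I \<Longrightarrow> N' $ i $ j = 0" "N' ** M = E" for N'
  proof -
    have "row_part I (transpose N') = transpose N'"
      using N'(1) by (auto simp: vec_eq_iff transpose_def row_part_def)
    then have "transpose (E ** transpose N') = transpose (transpose N')"
      by (simp add: E_def row_part_mat_mult)
    then have "N' = N' ** E" by (simp add: matrix_transpose_mul TE)
    also have "\<dots> = (N' ** M) ** N" by (simp only: MN[symmetric] matrix_mul_assoc)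
    also have "\<dots> = N" by (simp only: N'(2) EN)
    finally show ?thesis .
  qed
  have "block_inv I M = N"
    unfolding block_inv_def E_def[symmetric]
    by (rule the_equality) (use supp NM MN unique in blast)+
  with NM show ?thesis by simp
qed

section \<open>Gradients of integrals depending on a parameter\<close>

lemma GDERIV_along_line:
  assumes "GDERIV F x :> G"
  shows "((\<lambda>t. (F (x + t *\<^sub>R v) - F x) / t) \<longlongrightarrow> v \<bullet> G) (at 0)"
proof -
  have "((\<lambda>t. x + t *\<^sub>R v) has_derivative (\<lambda>t. t *\<^sub>R v)) (at 0)"
    by (auto intro!: derivative_eq_intros)
  moreover have "(F has_derivative (\<lambda>w. w \<bullet> G)) (at (x + 0 *\<^sub>R v))"
    using assms by (simp add: gderiv_def)
  ultimately have "((\<lambda>t. F (x + t *\<^sub>R v)) has_derivative (\<lambda>t. t *\<^sub>R v \<bullet> G)) (at 0)"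
    by (rule has_derivative_compose)
  then have "((\<lambda>t. F (x + t *\<^sub>R v)) has_real_derivative (v \<bullet> G)) (at 0)"
    unfolding has_field_derivative_def by (auto elim!: has_derivative_eq_rhs simp: fun_eq_iff)
  then show ?thesis by (simp add: has_field_derivative_iff)
qed

lemma differentiable_imp_GDERIV:
  fixes F :: "'a::euclidean_space \<Rightarrow> real"
  assumes "F differentiable (at x)"
  shows "GDERIV F x :> gradient F x"
proof -
  obtain F' where F': "(F has_derivative F') (at x)"
    using assms unfolding differentiable_def by auto
  interpret bounded_linear F' by (rule has_derivative_bounded_linear[OF F'])
  have "F' v = v \<bullet> (\<Sum>i\<in>Basis. F' i *\<^sub>R i)" for v
  proof -
    have "F' v = F' (\<Sum>i\<in>Basis. (v \<bullet> i) *\<^sub>R i)" by (simp add: euclidean_representation)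
    then show ?thesis by (simp only: sum scaleR) (simp add: inner_sum_right mult.commute)
  qed
  then have "GDERIV F x :> (\<Sum>i\<in>Basis. F' i *\<^sub>R i)"
    unfolding gderiv_def by (rule has_derivative_eq_rhs[OF F' ext])
  then show ?thesis using gradient_eqI by metis
qed

lemma norm_gradient_le:
  fixes F :: "'a::euclidean_space \<Rightarrow> real"
  assumes der: "GDERIV F x :> G" and r: "r > 0"
    and lip: "\<And>v. norm v < r \<Longrightarrow> \<bar>F (x + v) - F x\<bar> \<le> C * norm v"
  shows "norm G \<le> C"
proof -
  have "((\<lambda>t. \<bar>(F (x + t *\<^sub>R G) - F x) / t\<bar>) \<longlongrightarrow> \<bar>G \<bullet> G\<bar>) (at 0)"
    by (intro tendsto_intros GDERIV_along_line[OF der])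
  moreover have "eventually (\<lambda>t. \<bar>(F (x + t *\<^sub>R G) - F x) / t\<bar> \<le> C * norm G) (at 0)"
  proof -
    have "((\<lambda>t. norm (t *\<^sub>R G)) \<longlongrightarrow> norm ((0::real) *\<^sub>R G)) (at 0)"
      by (intro tendsto_intros)
    then have "eventually (\<lambda>t. norm (t *\<^sub>R G) < r) (at 0)"
      using r by (intro order_tendstoD(2)) auto
    moreover have "eventually (\<lambda>t::real. t \<noteq> 0) (at 0)" by (simp add: eventually_at_filter)
    ultimately show ?thesis
    proof eventually_elim
      case (elim t)
      have "\<bar>F (x + t *\<^sub>R G) - F x\<bar> \<le> C * norm (t *\<^sub>R G)" using elim(1) by (rule lip)
      also have "\<dots> = C * norm G * \<bar>t\<bar>" by simp
      finally show ?case using elim(2) by (simp add: abs_divide divide_le_eq)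
    qed
  qed
  ultimately have "\<bar>G \<bullet> G\<bar> \<le> C * norm G"
    by (rule tendsto_upperbound) simp
  then have "norm G * norm G \<le> C * norm G" by (simp add: power2_norm_eq_inner flip: power2_eq_square)
  moreover have "0 \<le> C"
  proof -
    obtain e :: 'a where "e \<in> Basis" using nonempty_Basis by blast
    then have "norm ((r/2) *\<^sub>R e) < r" "0 < norm ((r/2) *\<^sub>R e)" using r by auto
    with lip[of "(r/2) *\<^sub>R e"] have "0 \<le> C * norm ((r/2) *\<^sub>R e)" by linarith
    with \<open>0 < norm ((r/2) *\<^sub>R e)\<close> show ?thesis by (simp add: zero_le_mult_iff)
  qed
  ultimately show ?thesis by (cases "G = 0") auto
qed

text \<open>Differentiability at \<open>x\<close> is a Borel condition on the parameter: it says that for every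
  \<open>n\<close> some vector \<open>d\<close> of a countable dense set is a derivative of \<open>F q\<close> at \<open>x\<close> up to the error
  \<open>1/(n+1)\<close> on some ball of radius \<open>1/(m+1)\<close>, and for fixed \<open>n\<close>, \<open>d\<close>, \<open>m\<close> this is a closed
  condition.\<close>

lemma differentiable_parameters_borel:
  fixes F :: "'q::topological_space \<Rightarrow> 'a::euclidean_space \<Rightarrow> real"
  assumes cont: "\<And>x. continuous_on UNIV (\<lambda>q. F q x)"
  shows "{q. F q differentiable (at x)} \<in> sets borel"
proof -
  obtain D :: "'a set" where D: "countable D" "\<And>X. open X \<Longrightarrow> X \<noteq> {} \<Longrightarrow> \<exists>d\<in>D. d \<in> X"
    using countable_dense_setE by blast
  define good where "good n d m = {q. \<forall>v. norm v < 1 / real (Suc m) \<longrightarrow>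
      \<bar>F q (x + v) - F q x - v \<bullet> d\<bar> \<le> norm v / real (Suc n)}" for n d m
  have "good n d m = (\<Inter>v\<in>{v. norm v < 1 / real (Suc m)}.
      {q. \<bar>F q (x + v) - F q x - v \<bullet> d\<bar> \<le> norm v / real (Suc n)})" for n d m
    by (auto simp: good_def)
  then have "closed (good n d m)" for n d m
    by (auto intro!: closed_INT closed_Collect_le continuous_intros cont)
  then have "(\<Inter>n. \<Union>d\<in>D. \<Union>m. good n d m) \<in> sets borel"
    using D(1) by (intro sets.countable_INT'' sets.countable_UN') (auto simp: borel_closed)
  also have "(\<Inter>n. \<Union>d\<in>D. \<Union>m. good n d m) = {q. F q differentiable (at x)}"
  proof (intro set_eqI iffI)
    fix q assume "q \<in> {q. F q differentiable (at x)}"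
    then have der: "(F q has_derivative (\<lambda>v. v \<bullet> gradient (F q) x)) (at x)"
      using differentiable_imp_GDERIV by (auto simp: gderiv_def)
    show "q \<in> (\<Inter>n. \<Union>d\<in>D. \<Union>m. good n d m)"
    proof
      fix n :: nat
      define e where "e = 1 / (2 * real (Suc n))"
      have e: "e > 0" by (simp add: e_def)
      obtain r where r: "r > 0" "\<And>y. norm (y - x) < r \<Longrightarrow>
          norm (F q y - F q x - (y - x) \<bullet> gradient (F q) x) \<le> e * norm (y - x)"
        using der e unfolding has_derivative_at_alt by metis
      obtain m where m: "1 / real (Suc m) < r"
        using r(1) nat_approx_posE by (metis)
      obtain d where d: "d \<in> D" "norm (gradient (F q) x - d) < e"
        using D(2)[of "ball (gradient (F q) x) e"] e by (auto simp: dist_norm)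
      have "\<bar>F q (x + v) - F q x - v \<bullet> d\<bar> \<le> norm v / real (Suc n)" if "norm v < 1 / real (Suc m)" for v
      proof -
        have "\<bar>F q (x + v) - F q x - v \<bullet> gradient (F q) x\<bar> \<le> e * norm v"
          using r(2)[of "x + v"] that m by simp
        moreover have "\<bar>v \<bullet> (gradient (F q) x - d)\<bar> \<le> norm v * e"
          using Cauchy_Schwarz_ineq2[of v "gradient (F q) x - d"] d(2)
          by (meson less_imp_le mult_left_mono norm_ge_zero order_trans)
        moreover have "2 * (e * norm v) = norm v / real (Suc n)"
          by (simp add: e_def field_simps)
        ultimately show ?thesis by (simp add: inner_diff_right mult.commute)
      qed
      then have "q \<in> good n d m" by (simp add: good_def)
      with d(1) show "q \<in> (\<Union>d\<in>D. \<Union>m. good n d m)" by auto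
    qed
  next
    fix q assume "q \<in> (\<Inter>n. \<Union>d\<in>D. \<Union>m. good n d m)"
    then have "\<forall>n. \<exists>d m. q \<in> good n d m" by blast
    then obtain d m where dm: "\<And>n. q \<in> good n (d n) (m n)" by metis
    have approx: "\<bar>F q (x + v) - F q x - v \<bullet> d n\<bar> \<le> norm v / real (Suc n)"
      if "norm v < 1 / real (Suc (m n))" for v n
      using dm[of n] that by (simp add: good_def)
    have close: "norm (d n - d k) \<le> 1 / real (Suc n) + 1 / real (Suc k)" for n k
    proof (cases "d n = d k")
      case False
      define w where "w = d n - d k"
      \<comment> \<open>Both approximations hold at the short vector \<open>t *\<^sub>R w\<close>; its direction is the one on which
        \<open>d n\<close> and \<open>d k\<close> differ most.\<close>
      define \<rho> where "\<rho> = min (1 / real (Suc (m n))) (1 / real (Suc (m k)))"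
      define t where "t = \<rho> / (2 * norm w)"
      have \<rho>: "\<rho> > 0" "\<rho> \<le> 1 / real (Suc (m n))" "\<rho> \<le> 1 / real (Suc (m k))"
        by (simp_all add: \<rho>_def)
      have w: "norm w > 0" using False by (simp add: w_def)
      have t: "t > 0" using w \<rho>(1) by (simp add: t_def)
      have "norm (t *\<^sub>R w) = \<rho> / 2"
        using w t \<rho>(1) by (simp add: t_def)
      then have small: "norm (t *\<^sub>R w) < 1 / real (Suc (m n))"
          "norm (t *\<^sub>R w) < 1 / real (Suc (m k))"
        using \<rho> by linarith+
      have "t *\<^sub>R w \<bullet> w = t *\<^sub>R w \<bullet> d n - t *\<^sub>R w \<bullet> d k"
        by (simp add: w_def inner_diff_right)
      also have "\<dots> \<le> norm (t *\<^sub>R w) / real (Suc n) + norm (t *\<^sub>R w) / real (Suc k)"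
        using approx[OF small(1)] approx[OF small(2)] by linarith
      also have "\<dots> = t * norm w * (1 / real (Suc n) + 1 / real (Suc k))"
        using t by (simp add: field_simps)
      finally have "t * norm w * norm w \<le> t * norm w * (1 / real (Suc n) + 1 / real (Suc k))"
        by (simp add: mult.assoc power2_norm_eq_inner flip: power2_eq_square)
      then show ?thesis using t w unfolding w_def[symmetric] by simp
    qed simp
    have inv: "(\<lambda>n. 1 / real (Suc n)) \<longlonglongrightarrow> 0"
      using LIMSEQ_inverse_real_of_nat by (simp add: inverse_eq_divide)
    have "Cauchy d"
    proof (rule metric_CauchyI)
      fix e :: real assume e: "e > 0"
      obtain N where N: "1 / real (Suc N) < e / 2" using e nat_approx_posE[of "e/2"] by auto
      have "dist (d n) (d k) < e" if "n \<ge> N" "k \<ge> N" for n k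
      proof -
        have "1 / real (Suc n) \<le> 1 / real (Suc N)" "1 / real (Suc k) \<le> 1 / real (Suc N)"
          using that by (simp_all add: frac_le)
        then show ?thesis using close[of n k] N by (simp add: dist_norm)
      qed
      then show "\<exists>N. \<forall>n\<ge>N. \<forall>k\<ge>N. dist (d n) (d k) < e" by blast
    qed
    then obtain G where G: "d \<longlonglongrightarrow> G" using Cauchy_convergent convergent_def by blast
    have limit: "norm (d n - G) \<le> 1 / real (Suc n)" for n
    proof (rule tendsto_le[OF sequentially_bot])
      show "(\<lambda>k. 1 / real (Suc n) + 1 / real (Suc k)) \<longlonglongrightarrow> 1 / real (Suc n)"
        using tendsto_add[OF tendsto_const inv] by simp
      show "(\<lambda>k. norm (d n - d k)) \<longlonglongrightarrow> norm (d n - G)" by (intro tendsto_intros G)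
      show "eventually (\<lambda>k. norm (d n - d k) \<le> 1 / real (Suc n) + 1 / real (Suc k)) sequentially"
        using close by (intro always_eventually allI)
    qed
    have "(F q has_derivative (\<lambda>v. v \<bullet> G)) (at x)"
      unfolding has_derivative_at_alt
    proof (intro conjI allI impI)
      show "bounded_linear (\<lambda>v. v \<bullet> G)" by (rule bounded_linear_inner_left)
      fix e :: real assume e: "e > 0"
      obtain n where n: "1 / real (Suc n) < e / 2" using e nat_approx_posE[of "e/2"] by auto
      show "\<exists>r>0. \<forall>y. norm (y - x) < r \<longrightarrow>
          norm (F q y - F q x - (y - x) \<bullet> G) \<le> e * norm (y - x)"
      proof (intro exI[of _ "1 / real (Suc (m n))"] conjI allI impI)
        fix y assume y: "norm (y - x) < 1 / real (Suc (m n))"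
        have "\<bar>F q y - F q x - (y - x) \<bullet> d n\<bar> \<le> norm (y - x) * (1 / real (Suc n))"
          using approx[OF y] by simp
        moreover have "\<bar>(y - x) \<bullet> (d n - G)\<bar> \<le> norm (y - x) * (1 / real (Suc n))"
          using Cauchy_Schwarz_ineq2[of "y - x" "d n - G"] limit[of n]
          by (meson mult_left_mono norm_ge_zero order_trans)
        moreover have "norm (y - x) * (1 / real (Suc n)) \<le> norm (y - x) * (e / 2)"
          using n by (intro mult_left_mono) auto
        ultimately show "norm (F q y - F q x - (y - x) \<bullet> G) \<le> e * norm (y - x)"
          by (simp add: inner_diff_right mult.commute)
      qed simp
    qed
    then show "q \<in> {q. F q differentiable (at x)}" by (auto simp: differentiable_def)
  qed
  finally show ?thesis .
qed

text \<open>Off the set of differentiability the value of \<^const>\<open>gradient\<close> is one fixed default, so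
  the gradient is a limit of measurable functions: difference quotients on that set, a constant
  elsewhere.\<close>

lemma gradient_borel_measurable:
  fixes F :: "'q::topological_space \<Rightarrow> 'a::euclidean_space \<Rightarrow> real"
  assumes cont: "\<And>x. continuous_on UNIV (\<lambda>q. F q x)"
  shows "(\<lambda>q. gradient (F q) x) \<in> borel_measurable borel"
proof (rule borel_measurable_LIMSEQ_metric)
  define S where "S = {q. F q differentiable (at x)}"
  define quot where "quot n q = (if q \<in> S
      then \<Sum>i\<in>Basis. ((F q (x + (1 / real (Suc n)) *\<^sub>R i) - F q x) / (1 / real (Suc n))) *\<^sub>R i
      else (THE d. False))" for n q
  have [measurable]: "S \<in> sets borel" unfolding S_def by (rule differentiable_parameters_borel[OF cont])
  have [measurable]: "(\<lambda>q. F q z) \<in> borel_measurable borel" for z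
    by (rule borel_measurable_continuous_onI[OF cont])
  show "quot n \<in> borel_measurable borel" for n
    unfolding quot_def by measurable
  fix q
  show "(\<lambda>n. quot n q) \<longlonglongrightarrow> gradient (F q) x"
  proof (cases "q \<in> S")
    case True
    then have der: "GDERIV (F q) x :> gradient (F q) x"
      using differentiable_imp_GDERIV by (auto simp: S_def)
    have step: "filterlim (\<lambda>n. 1 / real (Suc n)) (at 0) sequentially"
      using LIMSEQ_inverse_real_of_nat by (auto simp: filterlim_at inverse_eq_divide)
    have "(\<lambda>n. \<Sum>i\<in>Basis. ((F q (x + (1 / real (Suc n)) *\<^sub>R i) - F q x) / (1 / real (Suc n))) *\<^sub>R i)
        \<longlonglongrightarrow> (\<Sum>i\<in>Basis. (i \<bullet> gradient (F q) x) *\<^sub>R i)"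
      (is "?lhs \<longlonglongrightarrow> ?rhs")
      by (intro tendsto_intros filterlim_compose[OF GDERIV_along_line[OF der] step])
    moreover have "?lhs = (\<lambda>n. quot n q)" using True by (simp add: quot_def)
    moreover have "?rhs = gradient (F q) x"
      by (subst inner_commute) (rule euclidean_representation)
    ultimately show ?thesis by simp
  next
    case False
    then have "\<not> GDERIV (F q) x :> d" for d
      by (auto simp: S_def gderiv_def differentiable_def)
    then have "gradient (F q) x = (THE d. False)" by (simp add: gradient_def)
    then show ?thesis using False by (simp add: quot_def)
  qed
qed

text \<open>The difference quotients at \<open>x\<close> are dominated by the Lipschitz constant, which is the same
  for all parameters, so it suffices that almost every \<open>F q\<close> is differentiable at this one
  point.\<close>

lemma gradient_of_integral:
  fixes F :: "'q \<Rightarrow> 'a::euclidean_space \<Rightarrow> real"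
  assumes M: "finite_measure M"
    and int: "\<And>x. integrable M (\<lambda>q. F q x)"
    and r: "r > 0"
    and lip: "\<And>q v. norm v < r \<Longrightarrow> \<bar>F q (x + v) - F q x\<bar> \<le> C * norm v"
    and meas: "(\<lambda>q. gradient (F q) x) \<in> borel_measurable M"
    and diff: "AE q in M. F q differentiable (at x)"
  shows integrable_gradient: "integrable M (\<lambda>q. gradient (F q) x)"
    and GDERIV_integral: "GDERIV (\<lambda>x'. \<integral>q. F q x' \<partial>M) x :> (\<integral>q. gradient (F q) x \<partial>M)"
proof -
  interpret finite_measure M by (rule M)
  have bound: "AE q in M. norm (gradient (F q) x) \<le> C"
    using diff by eventually_elim (rule norm_gradient_le[OF differentiable_imp_GDERIV r lip])
  show int_grad: "integrable M (\<lambda>q. gradient (F q) x)"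
    by (rule integrable_const_bound[OF bound meas])
  have rem: "(\<integral>q. (F q (x + v) - F q x - v \<bullet> gradient (F q) x) / norm v \<partial>M) =
      ((\<integral>q. F q (x + v) \<partial>M) - (\<integral>q. F q x \<partial>M) - v \<bullet> (\<integral>q. gradient (F q) x \<partial>M)) / norm v" for v
    using int int_grad by simp
  show "GDERIV (\<lambda>x'. \<integral>q. F q x' \<partial>M) x :> (\<integral>q. gradient (F q) x \<partial>M)"
    unfolding gderiv_def has_derivative_at
  proof (intro conjI bounded_linear_inner_left)
    show "((\<lambda>v. norm ((\<integral>q. F q (x + v) \<partial>M) - (\<integral>q. F q x \<partial>M)
        - v \<bullet> (\<integral>q. gradient (F q) x \<partial>M)) / norm v) \<longlongrightarrow> 0) (at 0)"
      unfolding tendsto_at_iff_sequentially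
    proof (intro allI impI)
      fix X :: "nat \<Rightarrow> 'a" assume X: "\<forall>i. X i \<in> UNIV - {0}" "X \<longlonglongrightarrow> 0"
      then obtain N where N: "\<And>n. n \<ge> N \<Longrightarrow> norm (X n) < r"
        using r LIMSEQ_D[of X 0 r] by auto
      have X0: "filterlim (\<lambda>n. X (n + N)) (at 0) sequentially"
        using X LIMSEQ_ignore_initial_segment[OF X(2)] by (auto simp: filterlim_at)
      have "(\<lambda>n. \<integral>q. (F q (x + X (n + N)) - F q x - X (n + N) \<bullet> gradient (F q) x)
          / norm (X (n + N)) \<partial>M) \<longlonglongrightarrow> (\<integral>q. 0 \<partial>M)"
      proof (rule integral_dominated_convergence[where w = "\<lambda>q. 2 * C"])
        show "AE q in M. (\<lambda>n. (F q (x + X (n + N)) - F q x - X (n + N) \<bullet> gradient (F q) x)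
          / norm (X (n + N))) \<longlonglongrightarrow> 0"
          using diff
        proof eventually_elim
          case (elim q)
          then have "((\<lambda>v. norm (F q (x + v) - F q x - v \<bullet> gradient (F q) x) / norm v) \<longlongrightarrow> 0) (at 0)"
            using differentiable_imp_GDERIV unfolding gderiv_def has_derivative_at by blast
          from filterlim_compose[OF this X0] show ?case
            by (subst tendsto_norm_zero_iff[symmetric]) (simp add: abs_divide)
        qed
        show "AE q in M. norm ((F q (x + X (n + N)) - F q x - X (n + N) \<bullet> gradient (F q) x)
          / norm (X (n + N))) \<le> 2 * C" for n
          using bound
        proof eventually_elim
          case (elim q)
          have "\<bar>F q (x + X (n + N)) - F q x\<bar> \<le> C * norm (X (n + N))"
            by (rule lip) (simp add: N)
          moreover have "\<bar>X (n + N) \<bullet> gradient (F q) x\<bar> \<le> C * norm (X (n + N))"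
            using Cauchy_Schwarz_ineq2[of "X (n + N)" "gradient (F q) x"] elim
            by (metis mult.commute mult_left_mono norm_ge_zero order_trans)
          ultimately have "\<bar>F q (x + X (n + N)) - F q x - X (n + N) \<bullet> gradient (F q) x\<bar>
              \<le> 2 * C * norm (X (n + N))" by linarith
          then show ?case using X(1) by (simp add: abs_divide divide_le_eq)
        qed
      qed (use int int_grad meas in \<open>auto intro!: borel_measurable_divide borel_measurable_diff
            borel_measurable_inner\<close>)
      then have "(\<lambda>n. norm ((\<integral>q. F q (x + X (n + N)) \<partial>M) - (\<integral>q. F q x \<partial>M)
          - X (n + N) \<bullet> (\<integral>q. gradient (F q) x \<partial>M)) / norm (X (n + N))) \<longlonglongrightarrow> 0"
        unfolding rem integral_zero by (drule_tac tendsto_norm_zero) (simp add: abs_divide)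
      then show "((\<lambda>v. norm ((\<integral>q. F q (x + v) \<partial>M) - (\<integral>q. F q x \<partial>M)
        - v \<bullet> (\<integral>q. gradient (F q) x \<partial>M)) / norm v) \<circ> X) \<longlonglongrightarrow> 0"
        unfolding o_def by (rule LIMSEQ_offset[where k = N])
    qed
  qed
qed

section \<open>The lower-level problem\<close>

locale lower_level =
  fixes g :: "(real^'u) \<times> (real^'l) \<Rightarrow> real"
    and A :: "real^'l^'k" and B :: "real^'u^'k" and b :: "real^'k" and \<mu> :: real
  assumes g_C2: "cont_diff2 g"
    and compact_feasible: "\<And>x. compact (feasible A B b x)"
    and mu_pos: "\<mu> > 0"
    and g_strongly_convex: "\<And>x. strongly_convex \<mu> (\<lambda>y. g (x, y))"
    and slater: "\<And>x. \<exists>y. \<forall>i. (A *v y + B *v x) $ i < b $ i"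
    and full_row_rank: "\<And>q x. rank (row_part (active A B b x (ystar g A B b q x)) A)
      = card (active A B b x (ystar g A B b q x))"
begin

abbreviation sol :: "real^'l \<Rightarrow> real^'u \<Rightarrow> real^'l" where
  "sol \<equiv> ystar g A B b"

abbreviation act :: "real^'l \<Rightarrow> real^'u \<Rightarrow> 'k set" where
  "act q x \<equiv> active A B b x (sol q x)"

text \<open>The partial gradient as a function of the pair, so that its joint continuity and its derivative
  in both variables are properties of one map.\<close>

abbreviation G :: "(real^'u) \<times> (real^'l) \<Rightarrow> real^'l" where
  "G z \<equiv> grad_y g (fst z) (snd z)"

lemma g_C1: "cont_diff g"
  by (rule cont_diff2_imp_cont_diff[OF g_C2])

lemma G_C1: "cont_diff G"
  by (rule cont_diff_grad_y[OF g_C2])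

lemma GDERIV_g: "GDERIV (\<lambda>y'. g (x, y')) y :> G (x, y)"
  using cont_diff_imp_has_derivative[OF g_C1] gderiv_grad_y by (metis fst_conv snd_conv)

lemma GDERIV_perturb: "GDERIV (\<lambda>y'. perturb g q (x, y')) y :> G (x, y) + q"
proof -
  have "GDERIV (\<lambda>y'. q \<bullet> y') y :> q"
    unfolding gderiv_def by (auto intro!: derivative_eq_intros simp: inner_commute)
  from GDERIV_add[OF GDERIV_g this] show ?thesis by (simp add: perturb_def)
qed

lemma G_strongly_monotone: "\<mu> * (norm (z - y))\<^sup>2 \<le> (z - y) \<bullet> (G (x, z) - G (x, y))"
  by (rule strongly_convex_gradient_monotone[OF g_strongly_convex GDERIV_g GDERIV_g])

subsection \<open>Existence and variational inequality\<close>

lemma mem_feasible: "y \<in> feasible A B b x \<longleftrightarrow> (\<forall>i. (A *v y) $ i + (B *v x) $ i \<le> b $ i)"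
  by (simp add: feasible_def)

lemma mem_active: "i \<in> active A B b x y \<longleftrightarrow> (A *v y) $ i + (B *v x) $ i = b $ i"
  by (simp add: active_def)

lemma sol_minimal:
  shows sol_feasible: "sol q x \<in> feasible A B b x"
    and "z \<in> feasible A B b x \<Longrightarrow> perturb g q (x, sol q x) \<le> perturb g q (x, z)"
proof -
  obtain y0 where "\<forall>i. (A *v y0 + B *v x) $ i < b $ i" using slater by blast
  then have "y0 \<in> feasible A B b x" by (simp add: mem_feasible less_imp_le)
  moreover have "continuous_on (feasible A B b x) (\<lambda>y. perturb g q (x, y))"
    by (rule continuous_at_imp_continuous_on)
      (use GDERIV_perturb in \<open>auto simp: gderiv_def dest: has_derivative_continuous\<close>)
  ultimately obtain y where "y \<in> feasible A B b x"
      "\<forall>z\<in>feasible A B b x. perturb g q (x, y) \<le> perturb g q (x, z)"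
    using continuous_attains_inf[OF compact_feasible] by blast
  then have "is_arg_min (\<lambda>y. perturb g q (x, y)) (\<lambda>y. y \<in> feasible A B b x) y"
    by (auto simp: is_arg_min_def not_less)
  then have "is_arg_min (\<lambda>y. perturb g q (x, y)) (\<lambda>y. y \<in> feasible A B b x) (sol q x)"
    unfolding ystar_def arg_min_on_def arg_min_def by (rule someI)
  then show "sol q x \<in> feasible A B b x"
    "z \<in> feasible A B b x \<Longrightarrow> perturb g q (x, sol q x) \<le> perturb g q (x, z)"
    by (auto simp: is_arg_min_def not_less)
qed

lemma feasible_segment:
  assumes y: "y \<in> feasible A B b x" and z: "z \<in> feasible A B b x" and t: "0 \<le> t" "t \<le> 1"
  shows "y + t *\<^sub>R (z - y) \<in> feasible A B b x"
  unfolding mem_feasible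
proof
  fix i
  have "(A *v (y + t *\<^sub>R (z - y))) $ i + (B *v x) $ i
      = (1 - t) * ((A *v y) $ i + (B *v x) $ i) + t * ((A *v z) $ i + (B *v x) $ i)"
    by (simp add: matrix_vector_right_distrib matrix_vector_mult_diff_distrib
        matrix_vector_mult_scaleR algebra_simps)
  also have "\<dots> \<le> (1 - t) * b $ i + t * b $ i"
    using y z t by (intro add_mono mult_left_mono) (auto simp: mem_feasible)
  finally show "(A *v (y + t *\<^sub>R (z - y))) $ i + (B *v x) $ i \<le> b $ i" by (simp add: algebra_simps)
qed

lemma sol_variational_inequality:
  assumes z: "z \<in> feasible A B b x"
  shows "0 \<le> (z - sol q x) \<bullet> (G (x, sol q x) + q)"
proof -
  have "((\<lambda>t. (perturb g q (x, sol q x + t *\<^sub>R (z - sol q x)) - perturb g q (x, sol q x)) / t)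
      \<longlongrightarrow> (z - sol q x) \<bullet> (G (x, sol q x) + q)) (at_right 0)"
    by (rule filterlim_mono[OF GDERIV_along_line[OF GDERIV_perturb] order_refl]) (simp add: at_le)
  moreover have "eventually (\<lambda>t::real. 0 < t \<and> t < 1) (at_right 0)"
    by (auto simp: eventually_at_right_field intro: exI[of _ 1])
  then have "eventually (\<lambda>t. 0 \<le> (perturb g q (x, sol q x + t *\<^sub>R (z - sol q x))
      - perturb g q (x, sol q x)) / t) (at_right 0)"
  proof eventually_elim
    case (elim t)
    then have "sol q x + t *\<^sub>R (z - sol q x) \<in> feasible A B b x"
      by (intro feasible_segment sol_feasible z) auto
    with sol_minimal(2) elim show ?case by simp
  qed
  ultimately show ?thesis by (rule tendsto_lowerbound) simp
qed

text \<open>The inactive constraints are strict at the solution and stay satisfied for a short step, so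
  only the active ones restrict the directions in which the variational inequality can be
  tested.\<close>

lemma feasible_direction:
  assumes d: "\<And>i. i \<in> act q x \<Longrightarrow> (A *v d) $ i \<le> 0"
  shows "0 \<le> d \<bullet> (G (x, sol q x) + q)"
proof -
  have "eventually (\<lambda>t. (A *v (sol q x + t *\<^sub>R d)) $ i + (B *v x) $ i \<le> b $ i) (at_right 0)" for i
  proof (cases "i \<in> act q x")
    case True
    have "eventually (\<lambda>t::real. 0 < t) (at_right 0)" by (simp add: eventually_at_right_less)
    then show ?thesis
    proof eventually_elim
      case (elim t)
      have "(A *v (sol q x + t *\<^sub>R d)) $ i = (A *v sol q x) $ i + t * (A *v d) $ i"
        by (simp add: matrix_vector_right_distrib matrix_vector_mult_scaleR)
      moreover have "t * (A *v d) $ i \<le> 0" using elim d[OF True] by (simp add: mult_nonneg_nonpos)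
      ultimately show ?case using True by (simp add: mem_active)
    qed
  next
    case False
    then have "(A *v sol q x) $ i + (B *v x) $ i < b $ i"
      using sol_feasible[of q x] by (auto simp: mem_feasible mem_active less_le)
    moreover have "((\<lambda>t. (A *v sol q x) $ i + t * (A *v d) $ i + (B *v x) $ i)
        \<longlongrightarrow> (A *v sol q x) $ i + 0 * (A *v d) $ i + (B *v x) $ i) (at_right 0)"
      by (intro tendsto_intros)
    ultimately have "eventually (\<lambda>t. (A *v sol q x) $ i + t * (A *v d) $ i + (B *v x) $ i < b $ i)
        (at_right 0)"
      by (intro order_tendstoD(2)) auto
    then show ?thesis
      by eventually_elim (simp add: matrix_vector_right_distrib matrix_vector_mult_scaleR)
  qed
  then have "eventually (\<lambda>t. \<forall>i. (A *v (sol q x + t *\<^sub>R d)) $ i + (B *v x) $ i \<le> b $ i) (at_right 0)"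
    by (simp add: eventually_all_finite)
  moreover have "eventually (\<lambda>t::real. 0 < t) (at_right 0)" by (simp add: eventually_at_right_less)
  ultimately have "eventually (\<lambda>t. 0 < t \<and> sol q x + t *\<^sub>R d \<in> feasible A B b x) (at_right 0)"
    by eventually_elim (simp add: mem_feasible)
  then obtain t where t: "0 < t" "sol q x + t *\<^sub>R d \<in> feasible A B b x"
    by (metis (mono_tags, lifting) eventually_happens' trivial_limit_at_right_real)
  then have "0 \<le> t *\<^sub>R d \<bullet> (G (x, sol q x) + q)"
    using sol_variational_inequality[OF t(2), of q] by simp
  with t(1) show ?thesis by (simp add: zero_le_mult_iff)
qed

subsection \<open>Bounds uniform in the perturbation\<close>

text \<open>A nonzero direction \<open>d\<close> with \<open>A d \<le> 0\<close> would be a recession direction of the compact set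
  of feasible points. Hence the positive part of \<open>A d\<close> is bounded below on the unit sphere, which
  controls feasible points by their right-hand side.\<close>

lemma feasible_growth:
  obtains c where "c > 0" "\<And>x y. y \<in> feasible A B b x \<Longrightarrow> norm y \<le> c * (1 + norm x)"
proof -
  define pos where "pos d = (\<Sum>i\<in>UNIV. max 0 ((A *v d) $ i))" for d
  have recession: "d = 0" if d: "\<And>i. (A *v d) $ i \<le> 0" for d
  proof (rule ccontr)
    assume "d \<noteq> 0"
    obtain y where y: "y \<in> feasible A B b 0"
      using sol_feasible by blast
    obtain K where K: "\<And>z. z \<in> feasible A B b 0 \<Longrightarrow> norm z \<le> K"
      using compact_imp_bounded[OF compact_feasible] unfolding bounded_iff by metis
    define t where "t = (K + norm y + 1) / norm d"
    have "0 \<le> K" using K[OF y] norm_ge_zero order_trans by blast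
    then have t: "t > 0" using \<open>d \<noteq> 0\<close> by (simp add: t_def add_nonneg_pos)
    have "y + t *\<^sub>R d \<in> feasible A B b 0"
      unfolding mem_feasible
    proof
      fix i
      have "t * (A *v d) $ i \<le> 0" using t d[of i] by (simp add: mult_nonneg_nonpos)
      moreover have "(A *v y) $ i + (B *v 0) $ i \<le> b $ i" using y by (simp add: mem_feasible)
      ultimately show "(A *v (y + t *\<^sub>R d)) $ i + (B *v 0) $ i \<le> b $ i"
        by (simp add: matrix_vector_right_distrib matrix_vector_mult_scaleR)
    qed
    then have "norm (y + t *\<^sub>R d) \<le> K" by (rule K)
    moreover have "norm (t *\<^sub>R d) = K + norm y + 1" using \<open>0 \<le> K\<close> \<open>d \<noteq> 0\<close>
      by (simp add: t_def)
    moreover have "norm (t *\<^sub>R d) \<le> norm (y + t *\<^sub>R d) + norm y"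
      using norm_triangle_ineq4[of "y + t *\<^sub>R d" y] by simp
    ultimately show False by linarith
  qed
  have "continuous_on (sphere 0 1) pos"
    unfolding pos_def by (intro continuous_intros linear_continuous_on matrix_vector_mul_bounded_linear)
  moreover have "axis undefined 1 \<in> sphere (0 :: real^'l) 1" by (simp add: norm_axis_1)
  ultimately obtain d0 :: "real^'l" where d0: "norm d0 = 1" "\<And>d. norm d = 1 \<Longrightarrow> pos d0 \<le> pos d"
    using continuous_attains_inf[of "sphere (0::real^'l) 1" pos] by auto
  have "pos d0 > 0"
  proof (rule ccontr)
    assume "\<not> pos d0 > 0"
    moreover have "pos d0 \<ge> 0" by (simp add: pos_def sum_nonneg)
    ultimately have "pos d0 = 0" by simp
    then have "\<And>i. max 0 ((A *v d0) $ i) = 0" unfolding pos_def by (simp add: sum_nonneg_eq_0_iff)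
    then have "(A *v d0) $ i \<le> 0" for i by (metis max.cobounded2)
    then have "d0 = 0" by (rule recession)
    with d0(1) show False by simp
  qed
  obtain K where K: "K > 0" "\<And>x. norm (B *v x) \<le> norm x * K"
    using bounded_linear.pos_bounded[OF matrix_vector_mul_bounded_linear] by blast
  define c where "c = real CARD('k) * (norm b + K) / pos d0"
  have bound: "norm y \<le> c * (1 + norm x)" if y: "y \<in> feasible A B b x" for x y
  proof -
    have "pos d0 * norm y \<le> pos y"
    proof (cases "y = 0")
      case False
      have "max 0 ((A *v y) $ i) = norm y * max 0 ((A *v (y /\<^sub>R norm y)) $ i)" for i
        using False by (auto simp: matrix_vector_mult_scaleR max_def zero_le_divide_iff
            zero_le_mult_iff)
      then have "pos y = norm y * pos (y /\<^sub>R norm y)"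
        unfolding pos_def by (simp add: sum_distrib_left)
      moreover have "pos d0 \<le> pos (y /\<^sub>R norm y)" using False by (intro d0(2)) simp
      ultimately show ?thesis by (simp add: mult.commute mult_left_mono)
    qed (simp add: pos_def sum_nonneg)
    also have "pos y \<le> (\<Sum>i\<in>(UNIV::'k set). norm b + norm (B *v x))"
      unfolding pos_def
    proof (rule sum_mono)
      fix i
      have "(A *v y) $ i \<le> b $ i - (B *v x) $ i" using y by (simp add: mem_feasible le_diff_eq)
      also have "\<dots> \<le> norm b + norm (B *v x)"
        using component_le_norm_cart[of b i] component_le_norm_cart[of "B *v x" i] by linarith
      finally show "max 0 ((A *v y) $ i) \<le> norm b + norm (B *v x)" by simp
    qed
    also have "\<dots> \<le> real CARD('k) * ((norm b + K) * (1 + norm x))"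
    proof -
      have "norm b + norm (B *v x) \<le> (norm b + K) * (1 + norm x)"
      proof -
        have "(norm b + K) * (1 + norm x) = norm b + norm x * K + (norm b * norm x + K)"
          by (simp add: algebra_simps)
        moreover have "0 \<le> norm b * norm x" by simp
        ultimately show ?thesis using K(1) K(2)[of x] by linarith
      qed
      then show ?thesis by (simp add: mult_left_mono)
    qed
    finally have "norm y \<le> real CARD('k) * ((norm b + K) * (1 + norm x)) / pos d0"
      using \<open>pos d0 > 0\<close> by (simp add: le_divide_eq mult.commute)
    then show ?thesis by (simp add: c_def)
  qed
  have "c > 0" using \<open>pos d0 > 0\<close> K(1)
    unfolding c_def by (intro divide_pos_pos mult_pos_pos add_nonneg_pos) auto
  then show thesis using bound by (rule that)
qed

text \<open>All solutions for \<open>x\<close> near \<open>x0\<close>, whatever the perturbation, lie in one compact convex set,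
  and the constants of \<open>G\<close> on that set are therefore independent of \<open>q\<close>.\<close>

lemma local_bounds:
  obtains R L where "R \<ge> 0" "L \<ge> 0"
    "\<And>q x. x \<in> cball x0 1 \<Longrightarrow> sol q x \<in> cball 0 R"
    "\<And>z z'. z \<in> cball x0 1 \<times> cball 0 R \<Longrightarrow> z' \<in> cball x0 1 \<times> cball 0 R \<Longrightarrow>
      norm (G z - G z') \<le> L * norm (z - z')"
proof -
  obtain c where c: "c > 0" "\<And>x y. y \<in> feasible A B b x \<Longrightarrow> norm y \<le> c * (1 + norm x)"
    using feasible_growth by blast
  define R where "R = c * (2 + norm x0)"
  have R: "R \<ge> 0" using c(1) by (simp add: R_def)
  have sol: "sol q x \<in> cball 0 R" if "x \<in> cball x0 1" for q x
  proof -
    have "norm x \<le> 1 + norm x0"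
      using that norm_triangle_ineq2[of x x0] by (simp add: dist_norm norm_minus_commute)
    then have "c * (1 + norm x) \<le> R" using c(1) by (simp add: R_def)
    then show ?thesis using c(2)[OF sol_feasible, of q x] by simp
  qed
  obtain L where "L \<ge> 0" "\<And>z z'. z \<in> cball x0 1 \<times> cball 0 R \<Longrightarrow> z' \<in> cball x0 1 \<times> cball 0 R \<Longrightarrow>
      norm (G z - G z') \<le> L * norm (z - z')"
    using cont_diff_lipschitz_on_compact[OF G_C1, of "cball x0 1 \<times> cball 0 R"]
    by (auto simp: compact_Times convex_Times)
  with R sol show thesis using that by blast
qed

text \<open>Continuity in \<open>q\<close> supplies the measurability of all integrands.\<close>

lemma sol_lipschitz_in_perturbation: "norm (sol q' x - sol q x) \<le> norm (q' - q) / \<mu>"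
proof -
  let ?y = "sol q x" and ?y' = "sol q' x"
  have "0 \<le> (?y' - ?y) \<bullet> (G (x, ?y) + q)" "0 \<le> (?y - ?y') \<bullet> (G (x, ?y') + q')"
    by (intro sol_variational_inequality sol_feasible)+
  then have "(?y' - ?y) \<bullet> (G (x, ?y') - G (x, ?y)) \<le> (?y' - ?y) \<bullet> (q - q')"
    by (simp add: inner_diff_left inner_diff_right inner_add_right)
  also have "\<dots> \<le> norm (?y' - ?y) * norm (q' - q)"
    using norm_cauchy_schwarz[of "?y' - ?y" "q - q'"] by (simp add: norm_minus_commute)
  finally have "\<mu> * (norm (?y' - ?y))\<^sup>2 \<le> norm (?y' - ?y) * norm (q' - q)"
    using G_strongly_monotone[of ?y' ?y x] by linarith
  then have "norm (?y' - ?y) * (\<mu> * norm (?y' - ?y)) \<le> norm (?y' - ?y) * norm (q' - q)"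
    by (simp add: power2_eq_square algebra_simps)
  then have "\<mu> * norm (?y' - ?y) \<le> norm (q' - q)"
    by (cases "?y' = ?y") auto
  then show ?thesis using mu_pos by (simp add: field_simps)
qed

lemma continuous_sol_in_perturbation: "continuous_on UNIV (\<lambda>q. sol q x)"
proof -
  have "(1 / \<mu>)-lipschitz_on UNIV (\<lambda>q. sol q x)"
    using mu_pos sol_lipschitz_in_perturbation by (intro lipschitz_onI) (auto simp: dist_norm)
  then show ?thesis by (rule lipschitz_on_continuous_on)
qed

subsection \<open>Lipschitz dependence on the upper-level variable\<close>

text \<open>Moving each of the two solutions a distance \<open>O(\<bar>x' - x\<bar>)\<close> towards a Slater point makes it
  feasible for the other problem. Inserting these points into the two variational inequalities
  bounds the squared distance of the solutions by a multiple of \<open>\<bar>x' - x\<bar>\<close>. This is only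
  Hoelder continuity, but it keeps inactive constraints inactive nearby.\<close>

lemma isCont_sol: "isCont (sol q) x"
proof -
  let ?y = "sol q x"
  obtain R L where RL: "R \<ge> 0" "L \<ge> 0" and sol_R: "\<And>q x'. x' \<in> cball x 1 \<Longrightarrow> sol q x' \<in> cball 0 R"
    and lip: "\<And>z z'. z \<in> cball x 1 \<times> cball 0 R \<Longrightarrow> z' \<in> cball x 1 \<times> cball 0 R \<Longrightarrow>
      norm (G z - G z') \<le> L * norm (z - z')"
    using local_bounds[of x] by blast
  obtain \<beta> where \<beta>: "\<beta> > 0" "\<And>v. norm (B *v v) \<le> norm v * \<beta>"
    using bounded_linear.pos_bounded[OF matrix_vector_mul_bounded_linear] by blast
  obtain s where s: "\<And>i. (A *v s + B *v x) $ i < b $ i" using slater by blast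
  define \<eta> where "\<eta> = Min (range (\<lambda>i. b $ i - (A *v s + B *v x) $ i))"
  have \<eta>: "\<eta> > 0" using s by (auto simp: \<eta>_def)
  have slack: "(A *v s) $ i + (B *v x) $ i \<le> b $ i - \<eta>" for i
  proof -
    have "\<eta> \<le> b $ i - (A *v s + B *v x) $ i" unfolding \<eta>_def by (rule Min_le) auto
    then show ?thesis by simp
  qed
  have "bounded (G ` (cball x 1 \<times> cball 0 R))"
    by (intro compact_imp_bounded compact_continuous_image compact_Times compact_cball
        cont_diff_imp_continuous_on[OF G_C1])
  then obtain M where M: "M > 0" "\<And>z. z \<in> cball x 1 \<times> cball 0 R \<Longrightarrow> norm (G z) \<le> M"
    unfolding bounded_pos by auto
  define K where "K = 2 * ((norm s + R) * (M + norm q))"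
  define C where "C = (L * (2 * R) + \<beta> / \<eta> * K) / \<mu>"
  \<comment> \<open>A step of relative length \<open>t = \<beta> / \<eta> * norm (x' - x)\<close> towards \<open>s\<close> gains the slack \<open>t * \<eta>\<close>,
    which absorbs the shift \<open>B *v (x' - x)\<close> of the constraints.\<close>
  have bound: "norm (sol q x' - ?y) \<le> sqrt (C * norm (x' - x))"
    if x': "norm (x' - x) \<le> min 1 (\<eta> / \<beta>)" for x'
  proof -
    let ?y' = "sol q x'"
    define t where "t = \<beta> / \<eta> * norm (x' - x)"
    have x'_ball: "x' \<in> cball x 1" "x \<in> cball x 1"
      using x' by (auto simp: dist_norm norm_minus_commute)
    have y_R: "norm ?y \<le> R" "norm ?y' \<le> R" using sol_R x'_ball by auto
    have "\<beta> * norm (x' - x) \<le> \<eta>" using x' \<beta>(1) \<eta> by (simp add: field_simps)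
    then have t: "0 \<le> t" "t \<le> 1" using \<beta>(1) \<eta> by (auto simp: t_def)
    have B: "\<bar>(B *v (x' - x)) $ i\<bar> \<le> t * \<eta>" for i
      using component_le_norm_cart[of "B *v (x' - x)" i] \<beta>(2)[of "x' - x"] \<eta>
      by (simp add: t_def mult.commute)
    have B_diff: "(B *v x') $ i = (B *v x) $ i + (B *v (x' - x)) $ i" for i
      by (simp add: matrix_vector_mult_diff_distrib)
    have combination: "(A *v (y + t *\<^sub>R (s - y))) $ i = (1 - t) * (A *v y) $ i + t * (A *v s) $ i"
      for y i
      by (simp add: matrix_vector_right_distrib matrix_vector_mult_diff_distrib
          matrix_vector_mult_scaleR algebra_simps)
    have "?y + t *\<^sub>R (s - ?y) \<in> feasible A B b x'"
      unfolding mem_feasible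
    proof
      fix i
      have "(A *v (?y + t *\<^sub>R (s - ?y))) $ i + (B *v x') $ i
          = (1 - t) * ((A *v ?y) $ i + (B *v x) $ i) + t * ((A *v s) $ i + (B *v x) $ i)
            + (B *v (x' - x)) $ i"
        unfolding combination B_diff by (simp add: algebra_simps)
      also have "\<dots> \<le> (1 - t) * b $ i + t * (b $ i - \<eta>) + t * \<eta>"
        using t slack sol_feasible[of q x] B[of i] abs_ge_self[of "(B *v (x' - x)) $ i"]
        by (intro add_mono mult_left_mono) (auto simp: mem_feasible)
      finally show "(A *v (?y + t *\<^sub>R (s - ?y))) $ i + (B *v x') $ i \<le> b $ i"
        by (simp add: algebra_simps)
    qed
    then have vi': "0 \<le> (?y + t *\<^sub>R (s - ?y) - ?y') \<bullet> (G (x', ?y') + q)"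
      by (rule sol_variational_inequality)
    have "?y' + t *\<^sub>R (s - ?y') \<in> feasible A B b x"
      unfolding mem_feasible
    proof
      fix i
      have "(A *v (?y' + t *\<^sub>R (s - ?y'))) $ i + (B *v x) $ i
          = (1 - t) * ((A *v ?y') $ i + (B *v x') $ i) + t * ((A *v s) $ i + (B *v x) $ i)
            + (1 - t) * (- (B *v (x' - x)) $ i)"
        unfolding combination B_diff by (simp add: algebra_simps)
      also have "\<dots> \<le> (1 - t) * b $ i + t * (b $ i - \<eta>) + 1 * (t * \<eta>)"
      proof (intro add_mono mult_left_mono)
        have "(1 - t) * (- (B *v (x' - x)) $ i) \<le> (1 - t) * (t * \<eta>)"
          using t B[of i] by (intro mult_left_mono) auto
        also have "\<dots> \<le> 1 * (t * \<eta>)" using t \<eta> by (intro mult_right_mono) auto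
        finally show "(1 - t) * (- (B *v (x' - x)) $ i) \<le> 1 * (t * \<eta>)" .
      qed (use t slack sol_feasible[of q x'] in \<open>auto simp: mem_feasible\<close>)
      finally show "(A *v (?y' + t *\<^sub>R (s - ?y'))) $ i + (B *v x) $ i \<le> b $ i"
        by (simp add: algebra_simps)
    qed
    then have vi: "0 \<le> (?y' + t *\<^sub>R (s - ?y') - ?y) \<bullet> (G (x, ?y) + q)"
      by (rule sol_variational_inequality)
    have test: "(s - y1) \<bullet> (G (x2, y2) + q) \<le> (norm s + R) * (M + norm q)"
      if "norm y1 \<le> R" "norm y2 \<le> R" "x2 \<in> cball x 1" for y1 x2 y2
    proof -
      have "norm (s - y1) \<le> norm s + R" using that(1) norm_triangle_ineq4[of s y1] by linarith
      moreover have "norm (G (x2, y2) + q) \<le> M + norm q"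
        using M(2)[of "(x2, y2)"] that norm_triangle_ineq[of "G (x2, y2)" q] by auto
      ultimately have "norm (s - y1) * norm (G (x2, y2) + q) \<le> (norm s + R) * (M + norm q)"
        using RL by (intro mult_mono) auto
      then show ?thesis using norm_cauchy_schwarz order_trans by blast
    qed
    have "(?y' - ?y) \<bullet> (G (x', ?y') - G (x, ?y))
        \<le> t * ((s - ?y') \<bullet> (G (x, ?y) + q)) + t * ((s - ?y) \<bullet> (G (x', ?y') + q))"
      using vi vi' by (simp add: inner_diff_left inner_diff_right inner_add_left inner_add_right
          algebra_simps)
    also have "\<dots> \<le> t * ((norm s + R) * (M + norm q)) + t * ((norm s + R) * (M + norm q))"
      using t y_R x'_ball by (intro add_mono mult_left_mono test) auto
    also have "\<dots> = t * K" by (simp add: K_def)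
    finally have sum: "(?y' - ?y) \<bullet> (G (x', ?y') - G (x, ?y)) \<le> t * K" .
    have "- ((?y' - ?y) \<bullet> (G (x', ?y) - G (x, ?y))) \<le> norm (?y' - ?y) * norm (G (x', ?y) - G (x, ?y))"
      using Cauchy_Schwarz_ineq2[of "?y' - ?y" "G (x', ?y) - G (x, ?y)"] by linarith
    also have "\<dots> \<le> (2 * R) * (L * norm (x' - x))"
    proof (intro mult_mono)
      show "norm (?y' - ?y) \<le> 2 * R" using y_R norm_triangle_ineq4[of ?y' ?y] by linarith
      show "norm (G (x', ?y) - G (x, ?y)) \<le> L * norm (x' - x)"
        using lip[of "(x', ?y)" "(x, ?y)"] y_R x'_ball by (simp add: norm_Pair)
    qed (use RL in auto)
    finally have "\<mu> * (norm (?y' - ?y))\<^sup>2 \<le> (2 * R) * (L * norm (x' - x)) + t * K"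
      using G_strongly_monotone[of ?y' ?y x'] sum by (simp add: inner_diff_right)
    also have "\<dots> = \<mu> * (C * norm (x' - x))"
      using mu_pos by (simp add: C_def t_def field_simps)
    finally have "(norm (?y' - ?y))\<^sup>2 \<le> C * norm (x' - x)" using mu_pos by simp
    then show ?thesis by (rule real_le_rsqrt)
  qed
  have "((\<lambda>x'. norm (x' - x)) \<longlongrightarrow> norm (x - x)) (at x)" by (intro tendsto_intros)
  then have "eventually (\<lambda>x'. norm (x' - x) < min 1 (\<eta> / \<beta>)) (at x)"
    using \<eta> \<beta>(1) by (intro order_tendstoD(2)) auto
  then have "eventually (\<lambda>x'. norm (sol q x' - ?y) \<le> sqrt (C * norm (x' - x))) (at x)"
    by eventually_elim (rule bound, simp)
  moreover
  have "((\<lambda>x'. sqrt (C * norm (x' - x))) \<longlongrightarrow> sqrt (C * norm (x - x))) (at x)"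
    by (intro tendsto_intros)
  then have "((\<lambda>x'. sqrt (C * norm (x' - x))) \<longlongrightarrow> 0) (at x)" by simp
  ultimately have "((\<lambda>x'. sol q x' - ?y) \<longlongrightarrow> 0) (at x)"
    by (rule Lim_null_comparison)
  then show ?thesis unfolding isCont_def by (simp add: LIM_zero_iff)
qed

lemma active_shrinks_nearby: "eventually (\<lambda>x'. act q x' \<subseteq> act q x) (nhds x)"
proof -
  have "eventually (\<lambda>x'. i \<notin> act q x') (nhds x)" if "i \<notin> act q x" for i
  proof -
    have "(sol q \<longlongrightarrow> sol q x) (nhds x)"
      using isCont_sol[of x q] by (simp add: continuous_at tendsto_nhds_iff)
    then have "((\<lambda>x'. (A *v sol q x') $ i + (B *v x') $ i)
        \<longlongrightarrow> (A *v sol q x) $ i + (B *v x) $ i) (nhds x)"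
      by (intro tendsto_intros bounded_linear.tendsto[OF matrix_vector_mul_bounded_linear] filterlim_ident)
    moreover have "(A *v sol q x) $ i + (B *v x) $ i < b $ i"
      using that sol_feasible[of q x] by (auto simp: mem_feasible mem_active less_le)
    ultimately have "eventually (\<lambda>x'. (A *v sol q x') $ i + (B *v x') $ i < b $ i) (nhds x)"
      by (rule order_tendstoD(2))
    then show ?thesis by eventually_elim (simp add: mem_active)
  qed
  then have "eventually (\<lambda>x'. i \<notin> act q x \<longrightarrow> i \<notin> act q x') (nhds x)" for i
    by (cases "i \<in> act q x") auto
  then have "eventually (\<lambda>x'. \<forall>i. i \<notin> act q x \<longrightarrow> i \<notin> act q x') (nhds x)"
    by (rule eventually_all_finite)
  then show ?thesis by eventually_elim blast
qed

text \<open>One right inverse per set of rows; as there are finitely many sets, one bound serves all.\<close>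

definition right_inv :: "'k set \<Rightarrow> real^'k^'l" where
  "right_inv I = (SOME P. row_part I A ** P = row_part I (mat 1))"

lemma row_part_right_inv:
  assumes "rank (row_part I A) = card I"
  shows "row_part I A ** right_inv I = row_part I (mat 1)"
  unfolding right_inv_def
  by (rule someI_ex) (metis assms full_row_rank_right_inverse)

lemma vec_part_right_inv:
  "vec_part (act q x) (A *v (right_inv (act q x) *v v)) = vec_part (act q x) v"
proof -
  have "row_part (act q x) A *v (right_inv (act q x) *v v) = row_part (act q x) (mat 1) *v v"
    by (simp only: matrix_vector_mul_assoc row_part_right_inv[OF full_row_rank])
  then show ?thesis by (simp only: row_part_mult_vec matrix_vector_mul_lid)
qed

lemma right_inv_component:
  assumes "i \<in> act q x"
  shows "(A *v (right_inv (act q x) *v v)) $ i = v $ i"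
  using arg_cong[OF vec_part_right_inv[of x q v], of "\<lambda>w. w $ i"] assms by simp

lemma right_inv_bounded:
  obtains \<kappa> where "\<kappa> \<ge> 0" "\<And>I v. norm (right_inv I *v v) \<le> \<kappa> * norm v"
proof
  let ?o = "\<lambda>I. onorm ((*v) (right_inv I))"
  have pos: "0 \<le> ?o I" for I by (intro onorm_pos_le matrix_vector_mul_bounded_linear)
  then show "(\<Sum>I\<in>UNIV. ?o I) \<ge> 0" by (simp add: sum_nonneg)
  fix I v
  have "norm (right_inv I *v v) \<le> ?o I * norm v"
    by (rule onorm[OF matrix_vector_mul_bounded_linear])
  also have "\<dots> \<le> (\<Sum>I\<in>UNIV. ?o I) * norm v"
    using pos by (intro mult_right_mono member_le_sum) auto
  finally show "norm (right_inv I *v v) \<le> (\<Sum>I\<in>UNIV. ?o I) * norm v" .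
qed

text \<open>Suppose that no new constraint becomes active in passing from \<open>x\<close> to \<open>x'\<close>, and let
  \<open>\<delta>\<close> be the displacement of the solution. Full row rank gives \<open>w = O(\<bar>x' - x\<bar>)\<close> with
  \<open>A w = - B (x' - x)\<close> on the active rows. Then \<open>\<delta> - w\<close> is a feasible direction at the old
  solution and \<open>w - \<delta>\<close> one at the new solution, so \<open>q\<close> drops out of the sum of the two
  first-order conditions, and strong monotonicity yields a constant that does not depend
  on \<open>q\<close>.\<close>

lemma sol_lipschitz_near:
  assumes L: "L \<ge> 0" and lip: "\<And>z z'. z \<in> S \<times> T \<Longrightarrow> z' \<in> S \<times> T \<Longrightarrow>
      norm (G z - G z') \<le> L * norm (z - z')"
    and \<kappa>: "\<kappa> \<ge> 0" "\<And>I v. norm (right_inv I *v v) \<le> \<kappa> * norm v"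
    and \<beta>: "\<beta> \<ge> 0" "\<And>v. norm (B *v v) \<le> norm v * \<beta>"
    and x: "x \<in> S" "x' \<in> S" and y: "sol q x \<in> T" "sol q x' \<in> T"
    and act: "act q x' \<subseteq> act q x"
  shows "norm (sol q x' - sol q x) \<le> (1 + (L + 2 * (\<kappa> * \<beta> * L)) / \<mu>) * norm (x' - x)"
proof -
  let ?I = "act q x" and ?y = "sol q x" and ?y' = "sol q x'"
  define \<Delta> where "\<Delta> = x' - x"
  define \<delta> where "\<delta> = ?y' - ?y"
  define w where "w = right_inv ?I *v (- (B *v \<Delta>))"
  have norm_w: "norm w \<le> \<kappa> * \<beta> * norm \<Delta>"
  proof -
    have "norm w \<le> \<kappa> * norm (B *v \<Delta>)" using \<kappa>(2)[of ?I "- (B *v \<Delta>)"] by (simp add: w_def)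
    also have "\<dots> \<le> \<kappa> * (norm \<Delta> * \<beta>)" using \<kappa>(1) \<beta>(2) by (intro mult_left_mono)
    finally show ?thesis by (simp add: mult.commute mult.left_commute)
  qed
  have slack: "(A *v (\<delta> - w)) $ i = (A *v ?y') $ i + (B *v x') $ i - b $ i" if "i \<in> ?I" for i
  proof -
    have "(A *v w) $ i = - (B *v \<Delta>) $ i"
      using right_inv_component[OF that, of "- (B *v \<Delta>)"] by (simp add: w_def)
    then show ?thesis
      using that by (simp add: mem_active \<delta>_def \<Delta>_def matrix_vector_mult_diff_distrib)
  qed
  have "0 \<le> (\<delta> - w) \<bullet> (G (x, ?y) + q)"
    using slack sol_feasible[of q x'] by (intro feasible_direction) (simp add: mem_feasible)
  moreover have "0 \<le> (- (\<delta> - w)) \<bullet> (G (x', ?y') + q)"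
  proof (rule feasible_direction)
    fix i assume "i \<in> act q x'"
    with act slack[of i] have "(A *v (\<delta> - w)) $ i = 0" by (auto simp: mem_active)
    moreover have "A *v (- (\<delta> - w)) = - (A *v (\<delta> - w))"
      using matrix_vector_mult_diff_distrib[of A 0 "\<delta> - w"] by simp
    ultimately show "(A *v (- (\<delta> - w))) $ i \<le> 0" by simp
  qed
  ultimately have key: "\<delta> \<bullet> (G (x', ?y') - G (x, ?y)) \<le> w \<bullet> (G (x', ?y') - G (x, ?y))"
    by (simp add: inner_diff_left inner_diff_right inner_add_right)
  have dG: "norm (G (x', ?y') - G (x, ?y)) \<le> L * (norm \<Delta> + norm \<delta>)"
  proof -
    have "norm (G (x', ?y') - G (x, ?y)) \<le> L * norm ((x', ?y') - (x, ?y))"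
      using x y by (intro lip) auto
    also have "\<dots> \<le> L * (norm \<Delta> + norm \<delta>)"
      using L norm_Pair_le[of \<Delta> \<delta>] by (intro mult_left_mono) (auto simp: \<Delta>_def \<delta>_def)
    finally show ?thesis .
  qed
  have "w \<bullet> (G (x', ?y') - G (x, ?y)) \<le> norm w * norm (G (x', ?y') - G (x, ?y))"
    by (rule norm_cauchy_schwarz)
  also have "\<dots> \<le> (\<kappa> * \<beta> * norm \<Delta>) * (L * (norm \<Delta> + norm \<delta>))"
    using norm_w dG \<kappa>(1) \<beta>(1) by (intro mult_mono) auto
  finally have w_part: "w \<bullet> (G (x', ?y') - G (x, ?y)) \<le> (\<kappa> * \<beta> * L) * norm \<Delta> * (norm \<Delta> + norm \<delta>)"
    by (simp add: algebra_simps)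
  have "- (\<delta> \<bullet> (G (x', ?y) - G (x, ?y))) \<le> norm \<delta> * norm (G (x', ?y) - G (x, ?y))"
    using Cauchy_Schwarz_ineq2[of \<delta> "G (x', ?y) - G (x, ?y)"] by linarith
  also have "\<dots> \<le> norm \<delta> * (L * norm \<Delta>)"
    using lip[of "(x', ?y)" "(x, ?y)"] x y
    by (intro mult_left_mono) (auto simp: norm_Pair \<Delta>_def)
  finally have "\<mu> * (norm \<delta>)\<^sup>2 \<le> L * norm \<Delta> * norm \<delta> + (\<kappa> * \<beta> * L) * norm \<Delta> * (norm \<Delta> + norm \<delta>)"
    using G_strongly_monotone[of ?y' ?y x'] key w_part
    by (simp add: \<delta>_def[symmetric] inner_diff_right algebra_simps)
  note quadratic = this
  show ?thesis
    unfolding \<Delta>_def[symmetric] \<delta>_def[symmetric]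
  proof (cases "norm \<delta> \<le> norm \<Delta>")
    case True
    have "0 \<le> (L + 2 * (\<kappa> * \<beta> * L)) / \<mu> * norm \<Delta>"
      using L \<kappa>(1) \<beta>(1) mu_pos by (intro mult_nonneg_nonneg divide_nonneg_pos add_nonneg_nonneg) auto
    with True show "norm \<delta> \<le> (1 + (L + 2 * (\<kappa> * \<beta> * L)) / \<mu>) * norm \<Delta>"
      by (simp add: algebra_simps)
  next
    case False
    \<comment> \<open>Bounding \<open>norm \<Delta>\<close> by \<open>norm \<delta>\<close> makes every term divisible by \<open>norm \<delta>\<close>.\<close>
    then have "(\<kappa> * \<beta> * L) * norm \<Delta> * (norm \<Delta> + norm \<delta>) \<le> (\<kappa> * \<beta> * L) * norm \<Delta> * (norm \<delta> + norm \<delta>)"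
      using L \<kappa>(1) \<beta>(1) by (intro mult_left_mono) auto
    with quadratic have "norm \<delta> * (\<mu> * norm \<delta>) \<le> norm \<delta> * ((L + 2 * (\<kappa> * \<beta> * L)) * norm \<Delta>)"
      by (simp add: power2_eq_square algebra_simps)
    moreover have "norm \<delta> > 0" using False norm_ge_zero[of \<Delta>] by linarith
    ultimately have "\<mu> * norm \<delta> \<le> (L + 2 * (\<kappa> * \<beta> * L)) * norm \<Delta>"
      by (simp only: mult_le_cancel_left_pos)
    then have "norm \<delta> \<le> (L + 2 * (\<kappa> * \<beta> * L)) / \<mu> * norm \<Delta>"
      using mu_pos by (simp add: pos_le_divide_eq mult.commute)
    then show "norm \<delta> \<le> (1 + (L + 2 * (\<kappa> * \<beta> * L)) / \<mu>) * norm \<Delta>"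
      by (simp add: algebra_simps add_increasing)
  qed
qed

text \<open>The neighbourhood in which no new constraint becomes active depends on \<open>q\<close>, but the constant
  does not; chaining along the segment removes the dependence of the neighbourhood as well.\<close>

lemma sol_lipschitz:
  obtains C where "C \<ge> 0"
    "\<And>q x'. x' \<in> ball x 1 \<Longrightarrow> norm (sol q x' - sol q x) \<le> C * norm (x' - x)"
proof -
  obtain R L where RL: "R \<ge> 0" "L \<ge> 0" and sol_R: "\<And>q x'. x' \<in> cball x 1 \<Longrightarrow> sol q x' \<in> cball 0 R"
    and lip: "\<And>z z'. z \<in> cball x 1 \<times> cball 0 R \<Longrightarrow> z' \<in> cball x 1 \<times> cball 0 R \<Longrightarrow>
      norm (G z - G z') \<le> L * norm (z - z')"
    using local_bounds[of x] by blast
  obtain \<beta> where \<beta>: "\<beta> > 0" "\<And>v. norm (B *v v) \<le> norm v * \<beta>"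
    using bounded_linear.pos_bounded[OF matrix_vector_mul_bounded_linear] by blast
  obtain \<kappa> where \<kappa>: "\<kappa> \<ge> 0" "\<And>I v. norm (right_inv I *v v) \<le> \<kappa> * norm v"
    using right_inv_bounded by blast
  define C where "C = 1 + (L + 2 * (\<kappa> * \<beta> * L)) / \<mu>"
  have "norm (sol q x' - sol q x) \<le> C * norm (x' - x)" if x': "x' \<in> ball x 1" for q x'
  proof (rule lipschitz_along_segment)
    fix p assume "p \<in> closed_segment x x'"
    moreover have "closed_segment x x' \<subseteq> ball x 1"
      using x' by (intro closed_segment_subset) auto
    ultimately have p: "p \<in> ball x 1" by blast
    then have "eventually (\<lambda>p'. p' \<in> ball x 1) (nhds p)"
      by (intro eventually_nhds_in_open) auto
    with active_shrinks_nearby[of q p]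
    show "eventually (\<lambda>p'. norm (sol q p' - sol q p) \<le> C * norm (p' - p)) (nhds p)"
    proof eventually_elim
      case (elim p')
      show ?case
        unfolding C_def
        by (rule sol_lipschitz_near[OF RL(2) lip \<kappa> less_imp_le[OF \<beta>(1)] \<beta>(2)])
          (use elim p sol_R ball_subset_cball in auto)
    qed
  qed
  moreover have "C \<ge> 0"
    using RL \<kappa>(1) \<beta>(1) mu_pos unfolding C_def by (intro add_nonneg_nonneg divide_nonneg_pos) auto
  ultimately show thesis using that by blast
qed

subsection \<open>Lagrange multipliers\<close>

lemma inner_vec_part: "vec_part I v \<bullet> w = v \<bullet> vec_part I (w :: real^'k)"
  by (auto simp: inner_vec_def intro!: sum.cong)

lemma inner_transpose: "v \<bullet> (transpose M *v w) = (M *v v) \<bullet> (w :: real^'m)"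
  for M :: "real^'n^'m"
  by (metis dot_lmul_matrix inner_commute transpose_matrix_vector)

text \<open>Complementarity is the statement that the multiplier is supported on the active set.\<close>

lemma lagrange_multiplier_iff:
  "lagrange_multiplier g A B b q x l \<longleftrightarrow>
    G (x, sol q x) + q + transpose A *v l = 0 \<and> (\<forall>i. l $ i \<ge> 0) \<and> vec_part (act q x) l = l"
proof -
  have "((\<lambda>y. l \<bullet> (A *v y + B *v x - b)) has_derivative (\<lambda>v. l \<bullet> (A *v v))) (at y)" for y
    by (auto intro!: derivative_eq_intros bounded_linear.has_derivative[OF matrix_vector_mul_bounded_linear])
  moreover have "l \<bullet> (A *v v) = v \<bullet> (transpose A *v l)" for v
    by (metis inner_transpose inner_commute)
  ultimately have "GDERIV (\<lambda>y. l \<bullet> (A *v y + B *v x - b)) y :> transpose A *v l" for y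
    by (simp add: gderiv_def)
  from GDERIV_add[OF GDERIV_perturb this]
  have der: "GDERIV (lagrangian g A B b q x l) y :> G (x, y) + q + transpose A *v l" for y
    by (simp add: lagrangian_def[abs_def])
  then have "GDERIV (lagrangian g A B b q x l) y :> 0 \<longleftrightarrow> G (x, y) + q + transpose A *v l = 0" for y
    using gradient_eqI by metis
  moreover have "(\<forall>i. l $ i * (A *v sol q x + B *v x - b) $ i = 0) \<longleftrightarrow> vec_part (act q x) l = l"
    by (auto simp: vec_eq_iff mem_active)
  ultimately show ?thesis by (simp add: lagrange_multiplier_def Let_def)
qed

text \<open>A right inverse of the active rows, or of any larger set of rows, recovers the multiplier
  from the gradient.\<close>

lemma multiplier_formula:
  assumes l: "lagrange_multiplier g A B b q x l" and sub: "act q x \<subseteq> I"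
    and P: "row_part I A ** P = row_part I (mat 1)"
  shows "l = - vec_part I (transpose P *v (G (x, sol q x) + q))"
proof -
  have supp: "vec_part I l = l"
  proof -
    have J: "vec_part (act q x) l = l" using l by (simp add: lagrange_multiplier_iff)
    have "l $ i = 0" if "i \<notin> I" for i
      using arg_cong[OF J, of "\<lambda>w. w $ i"] sub that
      by (auto split: if_splits)
    then show ?thesis by (simp add: vec_eq_iff)
  qed
  have eq: "G (x, sol q x) + q = - (transpose (row_part I A) *v l)"
    using l by (simp add: lagrange_multiplier_iff transpose_row_part_mult_vec supp
        eq_neg_iff_add_eq_0 del: transpose_matrix_vector)
  have "transpose P *v (transpose (row_part I A) *v l) = transpose (row_part I A ** P) *v l"
    by (simp only: matrix_vector_mul_assoc matrix_transpose_mul)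
  also have "\<dots> = l"
    by (simp only: P transpose_row_part_mat row_part_mult_vec matrix_vector_mul_lid supp)
  finally have "transpose P *v (- (transpose (row_part I A) *v l)) = - l"
    using matrix_vector_mult_diff_distrib[of "transpose P" 0 "transpose (row_part I A) *v l"]
    by (simp del: transpose_matrix_vector)
  with eq have "vec_part I (transpose P *v (G (x, sol q x) + q)) = vec_part I (- l)"
    by (simp del: transpose_matrix_vector)
  also have "\<dots> = - vec_part I l" by (simp add: vec_eq_iff)
  finally show ?thesis by (simp add: supp)
qed

text \<open>With independent active rows multipliers exist without a theorem of alternatives. A direction
  in the kernel of the active rows is feasible together with its negative, so the gradient vanishes
  on it; every direction differs from such a one by a combination of the columns of the right
  inverse. The negatives of these columns are feasible directions, which gives the multipliers
  their sign.\<close>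

lemma multiplier_exists: "\<exists>l. lagrange_multiplier g A B b q x l"
proof -
  let ?I = "act q x" and ?P = "right_inv (act q x)" and ?c = "G (x, sol q x) + q"
  define l where "l = - vec_part ?I (transpose ?P *v ?c)"
  have "d \<bullet> (?c + transpose A *v l) = 0" for d
  proof -
    define d' where "d' = d - ?P *v vec_part ?I (A *v d)"
    have "(A *v d') $ i = 0" if "i \<in> ?I" for i
      using that by (simp add: d'_def matrix_vector_mult_diff_distrib right_inv_component)
    moreover have "A *v (- d') = - (A *v d')"
      using matrix_vector_mult_diff_distrib[of A 0 d'] by simp
    ultimately have "0 \<le> d' \<bullet> ?c" "0 \<le> (- d') \<bullet> ?c"
      by (intro feasible_direction; simp)+
    then have "d \<bullet> ?c = (?P *v vec_part ?I (A *v d)) \<bullet> ?c" by (simp add: d'_def inner_diff_left)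
    also have "\<dots> = (A *v d) \<bullet> vec_part ?I (transpose ?P *v ?c)"
      by (simp only: inner_transpose[symmetric] inner_vec_part)
    also have "\<dots> = - (d \<bullet> (transpose A *v l))" 
      unfolding inner_transpose by (simp add: l_def del: transpose_matrix_vector)
    finally show ?thesis by (simp add: inner_add_right del: transpose_matrix_vector)
  qed
  then have "?c + transpose A *v l = 0" using inner_eq_zero_iff by blast
  moreover have "l $ i \<ge> 0" for i
  proof (cases "i \<in> ?I")
    case True
    let ?d = "?P *v (- axis i 1)"
    have "0 \<le> ?d \<bullet> ?c"
      by (rule feasible_direction) (simp add: right_inv_component axis_def)
    also have "\<dots> = (- axis i 1) \<bullet> (transpose ?P *v ?c)" by (simp only: inner_transpose)
    also have "\<dots> = l $ i" using True by (simp add: l_def inner_axis' del: transpose_matrix_vector)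
    finally show ?thesis .
  qed (simp add: l_def)
  moreover have "vec_part ?I l = l" by (simp add: l_def vec_eq_iff)
  ultimately show ?thesis using lagrange_multiplier_iff by blast
qed

lemma lambda_bar_multiplier: "lagrange_multiplier g A B b q x (lambda_bar g A B b q x)"
proof -
  have "\<exists>!l. lagrange_multiplier g A B b q x l"
    using multiplier_exists multiplier_formula[OF _ order_refl row_part_right_inv[OF full_row_rank]]
    by metis
  then have "lagrange_multiplier g A B b q x (THE l. lagrange_multiplier g A B b q x l)"
    by (rule theI')
  then show ?thesis unfolding lambda_bar_def using lagrange_multiplier_iff by metis
qed

lemma
  shows lambda_bar_stationary: "G (x, sol q x) + q + transpose A *v lambda_bar g A B b q x = 0"
    and lambda_bar_nonneg: "lambda_bar g A B b q x $ i \<ge> 0"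
    and lambda_bar_support: "vec_part (act q x) (lambda_bar g A B b q x) = lambda_bar g A B b q x"
  using lambda_bar_multiplier[of q x] by (auto simp: lagrange_multiplier_iff)

subsection \<open>Strict complementarity holds for almost every perturbation\<close>

text \<open>If the multiplier of the active constraint \<open>i\<close> vanishes, then \<open>q\<close> is determined by the
  solution and the remaining multipliers, which together have one degree of freedom less than
  \<open>q\<close>. To see this as a map between spaces of equal dimension, encode the solution \<open>y\<close> and the
  multipliers \<open>\<lambda>\<close> in the single vector \<open>w = y - y0 + P \<lambda>\<close>, where \<open>P\<close> is the right inverse of the
  active rows and \<open>y0\<close> some point on all active constraints: \<open>\<lambda>\<close> is the active part of \<open>A w\<close>, so
  that \<open>\<lambda> $ i = 0\<close> confines \<open>w\<close> to a hyperplane, and \<open>q\<close> is a differentiable function of \<open>w\<close>.\<close>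

lemma strict_complementarity_lborel:
  "AE q in lborel. \<forall>i\<in>act q x. lambda_bar g A B b q x $ i > 0"
proof -
  define y0 where "y0 J = right_inv J *v vec_part J (b - B *v x)" for J
  define \<Phi> where "\<Phi> J w = - G (x, y0 J + w - right_inv J *v vec_part J (A *v w))
      - transpose A *v vec_part J (A *v w)" for J w
  define H where "H i = {w. (A $ i) \<bullet> w = 0}" for i
  define N where "N = (\<Union>J. \<Union>i\<in>{i. A $ i \<noteq> 0}. \<Phi> J ` H i)"
  have "negligible (\<Phi> J ` H i)" if "A $ i \<noteq> 0" for J i
  proof (rule negligible_differentiable_image_negligible[OF order_refl])
    show "negligible (H i)" unfolding H_def using that by (intro negligible_hyperplane) auto
    have lin: "bounded_linear (\<lambda>w. vec_part J (A *v w))"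
      using matrix_vector_mul_bounded_linear[of "row_part J A"]
      unfolding row_part_mult_vec[abs_def] .
    obtain G' where G': "\<And>z. (G has_derivative blinfun_apply (G' z)) (at z)"
      using cont_diff_imp_has_derivative[OF G_C1] by blast
    have "((\<lambda>w. (x, y0 J + w - right_inv J *v vec_part J (A *v w)))
        has_derivative (\<lambda>v. (0, v - right_inv J *v vec_part J (A *v v)))) (at w)" for w
      by (auto intro!: derivative_eq_intros bounded_linear.has_derivative[OF lin]
          bounded_linear.has_derivative[OF matrix_vector_mul_bounded_linear])
    from has_derivative_compose[OF this G']
    have "(\<lambda>w. G (x, y0 J + w - right_inv J *v vec_part J (A *v w))) differentiable (at w)" for w
      by (rule differentiableI)
    moreover have "(\<lambda>w. transpose A *v vec_part J (A *v w)) differentiable (at w)" for w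
      by (rule bounded_linear_imp_differentiable)
        (rule bounded_linear_compose[OF matrix_vector_mul_bounded_linear lin])
    ultimately have "\<Phi> J differentiable (at w)" for w
      unfolding \<Phi>_def by (intro differentiable_diff differentiable_minus)
    then show "\<Phi> J differentiable_on H i"
      by (simp add: differentiable_at_imp_differentiable_on)
  qed
  then have "negligible N"
    unfolding N_def by (intro negligible_Union) auto
  then have "N \<in> null_sets lebesgue" by (simp add: negligible_iff_null_sets)
  moreover have "{q \<in> space lebesgue. \<not> (\<forall>i\<in>act q x. lambda_bar g A B b q x $ i > 0)} \<subseteq> N"
  proof
    fix q assume "q \<in> {q \<in> space lebesgue. \<not> (\<forall>i\<in>act q x. lambda_bar g A B b q x $ i > 0)}"
    then obtain i where i: "i \<in> act q x" "\<not> lambda_bar g A B b q x $ i > 0" by blast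
    with lambda_bar_nonneg[where q = q and x = x and i = i] have l0: "lambda_bar g A B b q x $ i = 0"
      by simp
    let ?J = "act q x" and ?y = "sol q x" and ?l = "lambda_bar g A B b q x"
    define w where "w = ?y - y0 ?J + right_inv ?J *v ?l"
    have "vec_part ?J (A *v ?y) = vec_part ?J (b - B *v x)"
      by (auto simp: vec_eq_iff mem_active)
    moreover have "vec_part ?J (A *v y0 ?J) = vec_part ?J (b - B *v x)"
      unfolding y0_def vec_part_right_inv by (simp add: vec_eq_iff)
    moreover have "vec_part ?J (A *v w)
        = vec_part ?J (A *v ?y) - vec_part ?J (A *v y0 ?J) + vec_part ?J (A *v (right_inv ?J *v ?l))"
      by (simp add: w_def vec_eq_iff matrix_vector_right_distrib matrix_vector_mult_diff_distrib)
    ultimately have Aw: "vec_part ?J (A *v w) = ?l"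
      by (simp add: vec_part_right_inv lambda_bar_support)
    have "y0 ?J + w - right_inv ?J *v ?l = ?y" by (simp add: w_def)
    then have "\<Phi> ?J w = - G (x, ?y) - transpose A *v ?l" by (simp only: \<Phi>_def Aw)
    also have "\<dots> = q - (G (x, ?y) + q + transpose A *v ?l)"
      by (simp del: transpose_matrix_vector)
    also have "\<dots> = q" by (simp only: lambda_bar_stationary diff_zero)
    finally have "q = \<Phi> ?J w" by simp
    moreover have "w \<in> H i"
      using arg_cong[OF Aw, of "\<lambda>v. v $ i"] i(1) l0 by (simp add: H_def matrix_vector_mul_component)
    moreover have "A $ i \<noteq> 0"
      using right_inv_component[OF i(1), of "axis i 1"]
      by (auto simp: matrix_vector_mul_component axis_def)
    ultimately show "q \<in> N" by (auto simp: N_def)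
  qed
  ultimately have "AE q in lebesgue. \<forall>i\<in>act q x. lambda_bar g A B b q x $ i > 0"
    by (intro AE_I') auto
  then show ?thesis by (simp add: AE_completion_iff)
qed

section \<open>Differentiability under strict complementarity\<close>

lemma G_linearization:
  "(G has_derivative (\<lambda>(v, w). hess_xy g x y *v v + hess_yy g x y *v w)) (at (x, y))"
proof -
  obtain G' where G': "(G has_derivative G') (at (x, y))"
    using cont_diff_imp_has_derivative[OF G_C1] by metis
  interpret bounded_linear G' by (rule has_derivative_bounded_linear[OF G'])
  have "((\<lambda>x'. G (x', y)) has_derivative (\<lambda>v. G' (v, 0))) (at x)"
    by (rule has_derivative_compose[where g = G and f = "\<lambda>x'. (x', y)"])
      (auto intro!: derivative_eq_intros G')
  then have x_part: "((\<lambda>x'. grad_y g x' y) has_derivative (\<lambda>v. G' (v, 0))) (at x)" by simp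
  then have "((\<lambda>x'. grad_y g x' y) has_derivative (\<lambda>v. hess_xy g x y *v v)) (at x)"
    using jacobian_works differentiableI unfolding hess_xy_def by blast
  then have x_eq: "G' (v, 0) = hess_xy g x y *v v" for v
    using has_derivative_unique[OF x_part] by metis
  have "((\<lambda>y'. G (x, y')) has_derivative (\<lambda>w. G' (0, w))) (at y)"
    by (rule has_derivative_compose[where g = G and f = "\<lambda>y'. (x, y')"])
      (auto intro!: derivative_eq_intros G')
  then have y_part: "((\<lambda>y'. grad_y g x y') has_derivative (\<lambda>w. G' (0, w))) (at y)" by simp
  then have "((\<lambda>y'. grad_y g x y') has_derivative (\<lambda>w. hess_yy g x y *v w)) (at y)"
    using jacobian_works differentiableI unfolding hess_yy_def by blast
  then have y_eq: "G' (0, w) = hess_yy g x y *v w" for w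
    using has_derivative_unique[OF y_part] by metis
  have "G' (v, w) = hess_xy g x y *v v + hess_yy g x y *v w" for v w
    using add[of "(v, 0)" "(0, w)"] by (simp add: x_eq y_eq)
  then have "G' = (\<lambda>(v, w). hess_xy g x y *v v + hess_yy g x y *v w)" by auto
  with G' show ?thesis by simp
qed

text \<open>Strong monotonicity of \<open>G\<close> in \<open>y\<close> passes to its derivative. Coercivity makes the Hessian
  invertible and its inverse positive definite, hence the block \<open>Abar ** Hinv ** transpose Abar\<close>
  injective on the active coordinates.\<close>

lemma hess_yy_coercive: "\<mu> * (norm w)\<^sup>2 \<le> w \<bullet> (hess_yy g x y *v w)"
proof -
  let ?H = "hess_yy g x y"
  have "((\<lambda>y'. w \<bullet> G (x, y')) has_derivative (\<lambda>v. w \<bullet> (?H *v v))) (at y)"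
  proof -
    have "((\<lambda>y'. (x, y')) has_derivative (\<lambda>v. (0, v))) (at y)"
      by (auto intro!: derivative_eq_intros)
    from has_derivative_compose[OF this G_linearization]
    show ?thesis by (intro has_derivative_inner_right) simp
  qed
  moreover have "w \<bullet> (?H *v v) = v \<bullet> (transpose ?H *v w)" for v
    by (metis inner_transpose inner_commute)
  ultimately have "GDERIV (\<lambda>y'. w \<bullet> G (x, y')) y :> transpose ?H *v w"
    by (simp add: gderiv_def)
  from GDERIV_along_line[OF this, of w]
  have "((\<lambda>t. (w \<bullet> G (x, y + t *\<^sub>R w) - w \<bullet> G (x, y)) / t) \<longlongrightarrow> w \<bullet> (transpose ?H *v w)) (at_right 0)"
    by (rule filterlim_mono[OF _ order_refl]) (simp add: at_le)
  moreover have "eventually (\<lambda>t::real. 0 < t) (at_right 0)" by (simp add: eventually_at_right_less)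
  then have "eventually (\<lambda>t. \<mu> * (norm w)\<^sup>2 \<le> (w \<bullet> G (x, y + t *\<^sub>R w) - w \<bullet> G (x, y)) / t) (at_right 0)"
  proof eventually_elim
    case (elim t)
    have "t * (t * (\<mu> * (norm w)\<^sup>2)) \<le> t * (w \<bullet> (G (x, y + t *\<^sub>R w) - G (x, y)))"
      using G_strongly_monotone[of "y + t *\<^sub>R w" y x] elim
      by (simp add: power_mult_distrib power2_eq_square algebra_simps)
    then have "t * (\<mu> * (norm w)\<^sup>2) \<le> w \<bullet> (G (x, y + t *\<^sub>R w) - G (x, y))"
      using elim by (simp only: mult_le_cancel_left_pos)
    then show ?case using elim by (simp add: pos_le_divide_eq inner_diff_right mult.commute)
  qed
  ultimately have "\<mu> * (norm w)\<^sup>2 \<le> w \<bullet> (transpose ?H *v w)" by (rule tendsto_lowerbound) simp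
  also have "\<dots> = w \<bullet> (?H *v w)" by (metis inner_transpose inner_commute)
  finally show ?thesis .
qed

lemma hess_yy_inverse:
  shows "hess_yy g x y ** matrix_inv (hess_yy g x y) = mat 1"
    and "matrix_inv (hess_yy g x y) ** hess_yy g x y = mat 1"
proof -
  have "v = 0" if "hess_yy g x y *v v = 0" for v
  proof -
    have "\<mu> * (norm v)\<^sup>2 \<le> 0" using hess_yy_coercive[of v x y] that by simp
    then show ?thesis using mu_pos by (simp add: mult_le_0_iff)
  qed
  from matrix_inv_mult[OF this] show "hess_yy g x y ** matrix_inv (hess_yy g x y) = mat 1"
    "matrix_inv (hess_yy g x y) ** hess_yy g x y = mat 1" by auto
qed

lemma schur_block_inv:
  fixes x y
  defines "Hinv \<equiv> matrix_inv (hess_yy g x y)"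
  assumes P: "row_part I A ** P = row_part I (mat 1)"
  shows "block_inv I (row_part I A ** Hinv ** transpose (row_part I A))
      ** (row_part I A ** Hinv ** transpose (row_part I A)) = row_part I (mat 1)"
proof (rule block_inv_mult)
  let ?A = "row_part I A"
  have EA: "row_part I (mat 1) ** ?A = ?A" by (simp add: row_part_mat_mult)
  then show "row_part I (mat 1) ** (?A ** Hinv ** transpose ?A) = ?A ** Hinv ** transpose ?A"
    by (simp only: matrix_mul_assoc)
  have "transpose ?A ** row_part I (mat 1) = transpose ?A"
    using arg_cong[OF EA, of transpose] by (simp only: matrix_transpose_mul transpose_row_part_mat)
  then show "?A ** Hinv ** transpose ?A ** row_part I (mat 1) = ?A ** Hinv ** transpose ?A"
    by (simp only: matrix_mul_assoc[symmetric])
  fix v assume v: "(?A ** Hinv ** transpose ?A) *v v = 0"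
  define u where "u = transpose ?A *v v"
  define z where "z = Hinv *v u"
  have u: "hess_yy g x y *v z = u"
    by (simp add: z_def Hinv_def matrix_vector_mul_assoc hess_yy_inverse)
  have "z \<bullet> u = (?A *v z) \<bullet> v" by (simp only: u_def inner_transpose)
  also have "\<dots> = v \<bullet> (?A *v z)" by (rule inner_commute)
  also have "\<dots> = v \<bullet> ((?A ** Hinv ** transpose ?A) *v v)"
    by (simp only: z_def u_def matrix_vector_mul_assoc matrix_mul_assoc)
  finally have "z \<bullet> u = 0" using v by simp
  then have "\<mu> * (norm z)\<^sup>2 \<le> 0" using hess_yy_coercive[of z x y] u by simp
  then have "z = 0" using mu_pos by (simp add: mult_le_0_iff)
  then have "u = 0" using u by simp
  then have "transpose P *v (transpose ?A *v v) = 0" by (simp add: u_def del: transpose_matrix_vector)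
  then have "transpose (?A ** P) *v v = 0"
    by (simp only: matrix_transpose_mul matrix_vector_mul_assoc)
  then show "vec_part I v = 0"
    by (simp only: P transpose_row_part_mat row_part_mult_vec matrix_vector_mul_lid)
qed

text \<open>As long as no new constraint becomes active, the multiplier is a continuous function of
  \<open>x'\<close>, expressed by one fixed right inverse. Its positive components stay positive, and a
  constraint with positive multiplier is active.\<close>

lemma active_constant_nearby:
  assumes strict: "\<And>i. i \<in> act q x \<Longrightarrow> lambda_bar g A B b q x $ i > 0"
  shows "eventually (\<lambda>x'. act q x' = act q x) (nhds x)"
proof -
  let ?I = "act q x"
  define P where "P = right_inv ?I"
  have P: "row_part ?I A ** P = row_part ?I (mat 1)"
    unfolding P_def by (rule row_part_right_inv[OF full_row_rank])
  define l where "l x' = - (transpose P *v (G (x', sol q x') + q))" for x'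
  have l_eq: "lambda_bar g A B b q x' $ i = l x' $ i" if "act q x' \<subseteq> ?I" "i \<in> ?I" for x' i
    using arg_cong[OF multiplier_formula[OF lambda_bar_multiplier that(1) P], of "\<lambda>v. v $ i"] that(2)
    by (simp add: l_def del: transpose_matrix_vector)
  have "(sol q \<longlongrightarrow> sol q x) (nhds x)"
    using isCont_sol[of x q] by (simp add: continuous_at tendsto_nhds_iff)
  then have "((\<lambda>x'. (x', sol q x')) \<longlongrightarrow> (x, sol q x)) (nhds x)"
    by (intro tendsto_intros filterlim_ident)
  moreover have "isCont G (x, sol q x)"
    using cont_diff_imp_continuous_on[OF G_C1, of UNIV] by (simp add: continuous_on_eq_continuous_at)
  ultimately have "((\<lambda>x'. G (x', sol q x')) \<longlongrightarrow> G (x, sol q x)) (nhds x)"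
    by (rule isCont_tendsto_compose[rotated])
  then have l_lim: "(l \<longlongrightarrow> l x) (nhds x)"
    unfolding l_def
    by (intro tendsto_intros bounded_linear.tendsto[OF matrix_vector_mul_bounded_linear])
  have "eventually (\<lambda>x'. i \<in> ?I \<longrightarrow> l x' $ i > 0) (nhds x)" for i
  proof (cases "i \<in> ?I")
    case True
    then have "l x $ i > 0" using strict[OF True] l_eq[OF order_refl True] by simp
    then have "eventually (\<lambda>x'. l x' $ i > 0) (nhds x)"
      by (intro order_tendstoD(1)[OF tendsto_vec_nth[OF l_lim]])
    then show ?thesis by eventually_elim simp
  qed simp
  then have "eventually (\<lambda>x'. \<forall>i. i \<in> ?I \<longrightarrow> l x' $ i > 0) (nhds x)"
    by (rule eventually_all_finite)
  with active_shrinks_nearby[of q x] show ?thesis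
  proof eventually_elim
    case (elim x')
    have "i \<in> act q x'" if "i \<in> ?I" for i
    proof (rule ccontr)
      assume "i \<notin> act q x'"
      then have "lambda_bar g A B b q x' $ i = 0"
        using arg_cong[OF lambda_bar_support[of x' q], of "\<lambda>v. v $ i"] by simp
      then show False using elim that l_eq[OF elim(1) that] by auto
    qed
    with elim(1) show ?case by blast
  qed
qed

text \<open>The Lipschitz bound on the solution turns the remainder in the linearization of the
  gradient of \<open>g\<close> along the solution path into a remainder in \<open>x' - x\<close> alone.\<close>

lemma G_along_solution_remainder:
  "((\<lambda>x'. G (x', sol q x') - G (x, sol q x) - hess_xy g x (sol q x) *v (x' - x)
      - hess_yy g x (sol q x) *v (sol q x' - sol q x)) has_derivative (\<lambda>v. 0)) (at x)"
  unfolding has_derivative_at_alt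
proof (intro conjI allI impI bounded_linear_zero)
  fix e :: real assume e: "e > 0"
  let ?y = "sol q x"
  obtain C where C: "C \<ge> 0"
    "\<And>x'. x' \<in> ball x 1 \<Longrightarrow> norm (sol q x' - ?y) \<le> C * norm (x' - x)"
    using sol_lipschitz[of x] by metis
  have "e / (1 + C) > 0" using e C(1) by simp
  then obtain d where d: "d > 0" "\<And>z. norm (z - (x, ?y)) < d \<Longrightarrow>
      norm (G z - G (x, ?y) - (case z - (x, ?y) of (v, w) \<Rightarrow>
        hess_xy g x ?y *v v + hess_yy g x ?y *v w)) \<le> e / (1 + C) * norm (z - (x, ?y))"
    using G_linearization[of x ?y] unfolding has_derivative_at_alt by metis
  have "norm (G (x', sol q x') - G (x, ?y) - hess_xy g x ?y *v (x' - x)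
      - hess_yy g x ?y *v (sol q x' - ?y)) \<le> e * norm (x' - x)"
    if x': "norm (x' - x) < min 1 (d / (1 + C))" for x'
  proof -
    have "x' \<in> ball x 1" using x' by (simp add: dist_norm norm_minus_commute)
    then have "norm (x' - x) + norm (sol q x' - ?y) \<le> (1 + C) * norm (x' - x)"
      using C(2)[of x'] by (simp add: algebra_simps)
    then have z: "norm ((x', sol q x') - (x, ?y)) \<le> (1 + C) * norm (x' - x)"
      using norm_Pair_le[of "x' - x" "sol q x' - ?y"] by simp
    also have "\<dots> < d" using x' C(1) by (simp add: pos_less_divide_eq mult.commute)
    finally have "norm ((x', sol q x') - (x, ?y)) < d" .
    from d(2)[OF this]
    have "norm (G (x', sol q x') - G (x, ?y) - hess_xy g x ?y *v (x' - x)
        - hess_yy g x ?y *v (sol q x' - ?y)) \<le> e / (1 + C) * norm ((x', sol q x') - (x, ?y))"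
      by (simp add: diff_diff_eq add.assoc)
    also have "\<dots> \<le> e / (1 + C) * ((1 + C) * norm (x' - x))"
      using z e C(1) by (intro mult_left_mono) auto
    also have "\<dots> = e * norm (x' - x)" using C(1) by simp
    finally show ?thesis .
  qed
  moreover have "min 1 (d / (1 + C)) > 0" using d(1) C(1) by simp
  ultimately show "\<exists>d>0. \<forall>x'. norm (x' - x) < d \<longrightarrow>
      norm (G (x', sol q x') - G (x, ?y) - hess_xy g x ?y *v (x' - x)
        - hess_yy g x ?y *v (sol q x' - ?y)
        - (G (x, ?y) - G (x, ?y) - hess_xy g x ?y *v (x - x) - hess_yy g x ?y *v (?y - ?y))
        - 0) \<le> e * norm (x' - x)"
    by (intro exI[of _ "min 1 (d / (1 + C))"]) auto
qed

text \<open>While the active set stays equal to \<open>I\<close>, the active constraints and the stationarity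
  condition are a system of equations for the increments of solution and multiplier that is
  linear up to the remainder above. Block elimination solves it explicitly, so that both increments
  are linear functions of \<open>x' - x\<close> and the remainder; no implicit function theorem is needed.\<close>

lemma sol_lambda_bar_derivative:
  fixes q x
  defines "y \<equiv> sol q x" and "I \<equiv> act q x"
  defines "Abar \<equiv> row_part I A" and "Bbar \<equiv> row_part I B"
    and "Hinv \<equiv> matrix_inv (hess_yy g x y)" and "Gxy \<equiv> hess_xy g x y"
  defines "Jlam \<equiv> - block_inv I (Abar ** Hinv ** transpose Abar) ** (Abar ** Hinv ** Gxy - Bbar)"
  defines "Jy \<equiv> Hinv ** (- Gxy - transpose Abar ** Jlam)"
  assumes strict: "\<And>i. i \<in> act q x \<Longrightarrow> lambda_bar g A B b q x $ i > 0"
  shows "(lambda_bar g A B b q has_derivative (\<lambda>v. Jlam *v v)) (at x)"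
    and "(sol q has_derivative (\<lambda>v. Jy *v v)) (at x)"
proof -
  let ?l = "lambda_bar g A B b q"
  define H where "H = hess_yy g x y"
  define M where "M = Abar ** Hinv ** transpose Abar"
  define N where "N = block_inv I M"
  define \<rho> where "\<rho> x' = G (x', sol q x') - G (x, y) - Gxy *v (x' - x) - H *v (sol q x' - y)" for x'
  have \<rho>_deriv: "(\<rho> has_derivative (\<lambda>v. 0)) (at x)"
    unfolding \<rho>_def Gxy_def H_def y_def by (rule G_along_solution_remainder)
  have \<rho>0: "\<rho> x = 0" by (simp add: \<rho>_def y_def)
  have NM: "N ** M = row_part I (mat 1)"
    unfolding N_def M_def Abar_def Hinv_def
    by (rule schur_block_inv[OF row_part_right_inv]) (simp add: I_def full_row_rank)
  have increments: "?l x' - ?l x = N *v (Bbar *v (x' - x) - Abar *v (Hinv *v (Gxy *v (x' - x) + \<rho> x')))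
      \<and> sol q x' - y = Hinv *v (- (Gxy *v (x' - x)) - transpose Abar *v (?l x' - ?l x) - \<rho> x')"
    if act: "act q x' = I" for x'
  proof -
    define \<Delta> where "\<Delta> = x' - x"
    define \<delta> where "\<delta> = sol q x' - y"
    define \<Lambda> where "\<Lambda> = ?l x' - ?l x"
    have A\<delta>: "Abar *v \<delta> = - (Bbar *v \<Delta>)"
    proof -
      have "(A *v \<delta>) $ i = - (B *v \<Delta>) $ i" if "i \<in> I" for i
      proof -
        have "(A *v sol q x') $ i + (B *v x') $ i = b $ i"
          using that act mem_active by metis
        moreover have "(A *v y) $ i + (B *v x) $ i = b $ i"
          using that mem_active unfolding I_def y_def by metis
        ultimately show ?thesis
          by (simp add: \<delta>_def \<Delta>_def matrix_vector_mult_diff_distrib)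
      qed
      then show ?thesis by (auto simp: Abar_def Bbar_def row_part_mult_vec vec_eq_iff)
    qed
    have supp: "vec_part I (?l x') = ?l x'" "vec_part I (?l x) = ?l x"
      using lambda_bar_support[of x' q] lambda_bar_support[of x q] act by (simp_all add: I_def)
    have \<Lambda>_supp: "vec_part I \<Lambda> = \<Lambda>"
    proof -
      have "vec_part I \<Lambda> = vec_part I (?l x') - vec_part I (?l x)" by (simp add: \<Lambda>_def vec_eq_iff)
      then show ?thesis by (simp add: supp \<Lambda>_def)
    qed
    have stationary: "G (x', sol q x') - G (x, y) = - (transpose Abar *v \<Lambda>)"
    proof -
      have "transpose Abar *v \<Lambda> = transpose A *v ?l x' - transpose A *v ?l x"
        unfolding Abar_def transpose_row_part_mult_vec \<Lambda>_supp
        by (simp only: \<Lambda>_def matrix_vector_mult_diff_distrib)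
      also have "\<dots> = (G (x', sol q x') + q + transpose A *v ?l x')
          - (G (x, y) + q + transpose A *v ?l x) - (G (x', sol q x') - G (x, y))"
        by (simp del: transpose_matrix_vector)
      also have "\<dots> = - (G (x', sol q x') - G (x, y))"
        by (simp only: lambda_bar_stationary y_def) simp
      finally show ?thesis by simp
    qed
    have "Hinv *v (H *v \<delta>) = \<delta>"
      by (simp add: matrix_vector_mul_assoc Hinv_def H_def hess_yy_inverse)
    moreover have "H *v \<delta> = - (Gxy *v \<Delta>) - transpose Abar *v \<Lambda> - \<rho> x'"
    proof -
      have "H *v \<delta> = (G (x', sol q x') - G (x, y)) - Gxy *v \<Delta> - \<rho> x'"
        by (simp add: \<rho>_def \<delta>_def \<Delta>_def)
      then show ?thesis by (simp only: stationary) (simp del: transpose_matrix_vector)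
    qed
    ultimately have \<delta>: "\<delta> = Hinv *v (- (Gxy *v \<Delta>) - transpose Abar *v \<Lambda> - \<rho> x')" by simp
    then have "\<delta> = - (Hinv *v (Gxy *v \<Delta> + \<rho> x')) - Hinv *v (transpose Abar *v \<Lambda>)"
    proof -
      have "- (Gxy *v \<Delta>) - transpose Abar *v \<Lambda> - \<rho> x'
          = 0 - (Gxy *v \<Delta> + \<rho> x') - transpose Abar *v \<Lambda>"
        by (simp del: transpose_matrix_vector)
      with \<delta> show ?thesis
        by (simp only: matrix_vector_mult_diff_distrib matrix_vector_mult_0_right) simp
    qed
    then have "Abar *v \<delta> = - (Abar *v (Hinv *v (Gxy *v \<Delta> + \<rho> x'))) - Abar *v (Hinv *v (transpose Abar *v \<Lambda>))"
      using matrix_vector_mult_diff_distrib[of Abar 0 "Hinv *v (Gxy *v \<Delta> + \<rho> x')"]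
      by (simp add: matrix_vector_mult_diff_distrib del: transpose_matrix_vector)
    moreover have "Abar *v (Hinv *v (transpose Abar *v \<Lambda>)) = M *v \<Lambda>"
      by (simp only: M_def matrix_vector_mul_assoc matrix_mul_assoc)
    ultimately have "M *v \<Lambda> = Bbar *v \<Delta> - Abar *v (Hinv *v (Gxy *v \<Delta> + \<rho> x'))"
      using A\<delta> by (simp add: algebra_simps)
    moreover have "N *v (M *v \<Lambda>) = \<Lambda>"
      by (simp only: matrix_vector_mul_assoc NM row_part_mult_vec matrix_vector_mul_lid \<Lambda>_supp)
    ultimately have "\<Lambda> = N *v (Bbar *v \<Delta> - Abar *v (Hinv *v (Gxy *v \<Delta> + \<rho> x')))" by simp
    with \<delta> show ?thesis by (simp only: \<delta>_def \<Delta>_def \<Lambda>_def)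
  qed
  have nearby: "eventually (\<lambda>x'. act q x' = I) (nhds x)"
    unfolding I_def by (rule active_constant_nearby[OF strict])
  note linear = bounded_linear.has_derivative[OF matrix_vector_mul_bounded_linear]
  have "((\<lambda>x'. N *v (Bbar *v (x' - x) - Abar *v (Hinv *v (Gxy *v (x' - x) + \<rho> x'))) + ?l x)
      has_derivative (\<lambda>v. N *v (Bbar *v (v - 0) - Abar *v (Hinv *v (Gxy *v (v - 0) + 0))) + 0)) (at x)"
    by (intro has_derivative_add has_derivative_diff linear has_derivative_const has_derivative_ident
        \<rho>_deriv)
  then show l_deriv: "(?l has_derivative (\<lambda>v. Jlam *v v)) (at x)"
  proof (rule has_derivative_eventually_eq)
    show "eventually (\<lambda>x'. N *v (Bbar *v (x' - x) - Abar *v (Hinv *v (Gxy *v (x' - x) + \<rho> x')))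
        + ?l x = ?l x') (nhds x)"
      using nearby
      by eventually_elim (rule eq_diff_eq[THEN iffD1, OF increments[THEN conjunct1, symmetric]])
    fix v
    have neg: "(- N) *v w = N *v (0 - w)" for w
      by (simp add: vec_eq_iff matrix_vector_mult_def sum_negf)
    have "Jlam *v v = (- N) *v ((Abar ** Hinv ** Gxy - Bbar) *v v)"
      by (simp only: Jlam_def N_def M_def matrix_vector_mul_assoc)
    also have "\<dots> = N *v (Bbar *v v - Abar *v (Hinv *v (Gxy *v v)))"
      by (simp only: neg matrix_vector_mult_diff_rdistrib matrix_vector_mul_assoc matrix_mul_assoc) simp
    finally show "N *v (Bbar *v (v - 0) - Abar *v (Hinv *v (Gxy *v (v - 0) + 0))) + 0 = Jlam *v v"
      by simp
  qed
  have "((\<lambda>x'. Hinv *v (- (Gxy *v (x' - x)) - transpose Abar *v (?l x' - ?l x) - \<rho> x') + y)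
      has_derivative (\<lambda>v. Hinv *v (- (Gxy *v (v - 0)) - transpose Abar *v (Jlam *v v - 0) - 0) + 0)) (at x)"
    by (intro has_derivative_add has_derivative_diff has_derivative_minus linear has_derivative_const
        has_derivative_ident \<rho>_deriv l_deriv)
  then show "(sol q has_derivative (\<lambda>v. Jy *v v)) (at x)"
  proof (rule has_derivative_eventually_eq)
    show "eventually (\<lambda>x'. Hinv *v (- (Gxy *v (x' - x)) - transpose Abar *v (?l x' - ?l x) - \<rho> x')
        + y = sol q x') (nhds x)"
      using nearby
      by eventually_elim (rule eq_diff_eq[THEN iffD1, OF increments[THEN conjunct2, symmetric]])
    fix v
    have "- (Gxy *v v) = (- Gxy) *v v" by (simp add: vec_eq_iff matrix_vector_mult_def sum_negf)
    then show "Hinv *v (- (Gxy *v (v - 0)) - transpose Abar *v (Jlam *v v - 0) - 0) + 0 = Jy *v v"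
      by (simp only: Jy_def diff_zero add_0_right matrix_vector_mult_diff_rdistrib
          matrix_vector_mul_assoc[symmetric])
  qed
qed

section \<open>The implicit objective\<close>

lemma continuous_implicit_obj_in_perturbation:
  assumes "cont_diff h"
  shows "continuous_on UNIV (\<lambda>q. implicit_obj h g A B b q x)"
  unfolding implicit_obj_def
  by (rule continuous_on_compose2[OF cont_diff_imp_continuous_on[OF assms, of UNIV]])
    (auto intro!: continuous_intros continuous_sol_in_perturbation)

lemma implicit_obj_bounded:
  assumes "cont_diff h"
  obtains K where "\<And>q. \<bar>implicit_obj h g A B b q x\<bar> \<le> K"
proof -
  obtain R where R: "\<And>q x'. x' \<in> cball x 1 \<Longrightarrow> sol q x' \<in> cball 0 R"
    using local_bounds[of x] by metis
  have "bounded (h ` ({x} \<times> cball 0 R))"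
    by (intro compact_imp_bounded compact_continuous_image compact_Times compact_cball
        cont_diff_imp_continuous_on[OF assms]) auto
  then obtain K where "\<And>z. z \<in> {x} \<times> cball 0 R \<Longrightarrow> norm (h z) \<le> K"
    unfolding bounded_iff by blast
  then show thesis using R[of x] by (intro that[of K]) (auto simp: implicit_obj_def)
qed

text \<open>The constant is the dominating function for differentiating under the expectation.\<close>

lemma implicit_obj_lipschitz:
  assumes "cont_diff h"
  obtains C where "\<And>q v. norm v < 1 \<Longrightarrow>
    \<bar>implicit_obj h g A B b q (x + v) - implicit_obj h g A B b q x\<bar> \<le> C * norm v"
proof -
  obtain R where R: "\<And>q x'. x' \<in> cball x 1 \<Longrightarrow> sol q x' \<in> cball 0 R"
    using local_bounds[of x] by metis
  obtain L where L: "L \<ge> 0" "\<And>z z'. z \<in> cball x 1 \<times> cball 0 R \<Longrightarrow> z' \<in> cball x 1 \<times> cball 0 R \<Longrightarrow>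
      norm (h z - h z') \<le> L * norm (z - z')"
    using cont_diff_lipschitz_on_compact[OF assms, of "cball x 1 \<times> cball 0 R"]
    by (auto simp: compact_Times convex_Times)
  obtain C where C: "C \<ge> 0"
    "\<And>q x'. x' \<in> ball x 1 \<Longrightarrow> norm (sol q x' - sol q x) \<le> C * norm (x' - x)"
    using sol_lipschitz[of x] by metis
  have "\<bar>implicit_obj h g A B b q (x + v) - implicit_obj h g A B b q x\<bar> \<le> L * (1 + C) * norm v"
    if v: "norm v < 1" for q v
  proof -
    have ball: "x + v \<in> ball x 1" "x + v \<in> cball x 1" "x \<in> cball x 1" using v by (auto simp: dist_norm)
    have "\<bar>implicit_obj h g A B b q (x + v) - implicit_obj h g A B b q x\<bar>
        \<le> L * norm ((x + v, sol q (x + v)) - (x, sol q x))"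
      using L(2)[of "(x + v, sol q (x + v))" "(x, sol q x)"] ball R
      by (simp add: implicit_obj_def)
    also have "\<dots> \<le> L * ((1 + C) * norm v)"
      using L(1) norm_Pair_le[of v "sol q (x + v) - sol q x"] C(2)[OF ball(1), of q]
      by (intro mult_left_mono) (auto simp: algebra_simps)
    finally show ?thesis by (simp add: mult.assoc)
  qed
  then show thesis by (rule that)
qed

lemma GDERIV_implicit_obj:
  assumes h: "cont_diff h" and J: "(sol q has_derivative (\<lambda>v. J *v v)) (at x)"
  shows "GDERIV (implicit_obj h g A B b q) x :>
    grad_x h x (sol q x) + transpose J *v grad_y h x (sol q x)"
proof -
  obtain h' where h': "(h has_derivative h') (at (x, sol q x))"
    using cont_diff_imp_has_derivative[OF h] by metis
  have "((\<lambda>x'. (x', sol q x')) has_derivative (\<lambda>v. (v, J *v v))) (at x)"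
    by (intro has_derivative_Pair has_derivative_ident J)
  from has_derivative_compose[OF this h']
  have "(implicit_obj h g A B b q has_derivative (\<lambda>v. h' (v, J *v v))) (at x)"
    by (simp add: implicit_obj_def[abs_def])
  moreover have "h' (v, J *v v) = v \<bullet> (grad_x h x (sol q x) + transpose J *v grad_y h x (sol q x))" for v
    unfolding derivative_eq_partial_gradients[OF h'] inner_add_right inner_transpose ..
  ultimately show ?thesis by (simp add: gderiv_def del: transpose_matrix_vector)
qed

lemma expected_implicit_obj:
  assumes h: "cont_diff h" and Q: "prob_space Q" "sets Q = sets borel"
    and diff: "\<And>x. AE q in Q. implicit_obj h g A B b q differentiable (at x)"
  shows "integrable Q (\<lambda>q. implicit_obj h g A B b q x)"
    and "(\<lambda>x'. \<integral>q. implicit_obj h g A B b q x' \<partial>Q) differentiable (at x)"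
    and "integrable Q (\<lambda>q. gradient (implicit_obj h g A B b q) x)"
    and "gradient (\<lambda>x'. \<integral>q. implicit_obj h g A B b q x' \<partial>Q) x
      = (\<integral>q. gradient (implicit_obj h g A B b q) x \<partial>Q)"
proof -
  interpret prob_space Q by (rule Q(1))
  have borel: "borel_measurable Q = (borel_measurable borel :: ((real^'l) \<Rightarrow> 'c::topological_space) set)"
    by (rule measurable_cong_sets[OF Q(2) refl])
  have cont: "continuous_on UNIV (\<lambda>q. implicit_obj h g A B b q z)" for z
    by (rule continuous_implicit_obj_in_perturbation[OF h])
  have int: "integrable Q (\<lambda>q. implicit_obj h g A B b q z)" for z
  proof -
    obtain K where "\<And>q. \<bar>implicit_obj h g A B b q z\<bar> \<le> K"
      using implicit_obj_bounded[OF h] by metis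
    then show ?thesis
      by (intro integrable_const_bound[of _ K])
        (auto simp: borel intro: borel_measurable_continuous_onI cont)
  qed
  obtain C where C: "\<And>q v. norm v < 1 \<Longrightarrow>
      \<bar>implicit_obj h g A B b q (x + v) - implicit_obj h g A B b q x\<bar> \<le> C * norm v"
    using implicit_obj_lipschitz[OF h] by metis
  have "(\<lambda>q. gradient (implicit_obj h g A B b q) x) \<in> borel_measurable Q"
    unfolding borel by (rule gradient_borel_measurable[OF cont])
  note grad = gradient_of_integral[where F = "\<lambda>q. implicit_obj h g A B b q",
      OF finite_measure_axioms int zero_less_one C this diff]
  show "integrable Q (\<lambda>q. implicit_obj h g A B b q x)" by (rule int)
  show "integrable Q (\<lambda>q. gradient (implicit_obj h g A B b q) x)" by (rule grad(1))
  show "(\<lambda>x'. \<integral>q. implicit_obj h g A B b q x' \<partial>Q) differentiable (at x)"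
    using grad(2) unfolding gderiv_def by (rule differentiableI)
  show "gradient (\<lambda>x'. \<integral>q. implicit_obj h g A B b q x' \<partial>Q) x
      = (\<integral>q. gradient (implicit_obj h g A B b q) x \<partial>Q)"
    by (rule gradient_eqI[OF grad(2)])
qed

end

theorem proposition2p3:
  fixes f g :: "(real^'u) \<times> (real^'l) \<Rightarrow> real"
    and ft :: "'xi \<Rightarrow> (real^'u) \<times> (real^'l) \<Rightarrow> real"
    and Df :: "'xi measure"
    and Q :: "(real^'l) measure"
    and A :: "real^'l^'k" and B :: "real^'u^'k" and b :: "real^'k"
    and \<mu> :: real
  assumes Df: "prob_space Df"
    and ft_int: "\<And>z. integrable Df (\<lambda>\<xi>. ft \<xi> z)"
    and f_eq: "\<And>z. f z = (\<integral>\<xi>. ft \<xi> z \<partial>Df)"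
    and Q: "prob_space Q" "sets Q = sets borel" "absolutely_continuous lborel Q"
    and f_C1: "cont_diff f"
    and ft_C1: "\<And>\<xi>. \<xi> \<in> space Df \<Longrightarrow> cont_diff (ft \<xi>)"
    and g_C2: "cont_diff2 g"
    and compact_feasible: "\<And>x. compact (feasible A B b x)"
    and mu_pos: "\<mu> > 0"
    and g_strongly_convex: "\<And>x. strongly_convex \<mu> (\<lambda>y. g (x, y))"
    and slater: "\<And>x. \<exists>y. \<forall>i. (A *v y + B *v x) $ i < b $ i"
    and full_row_rank: "\<And>q x. let I = active A B b x (ystar g A B b q x) in
                                rank (row_part I A) = card I"
  shows
    "(\<forall>x. integrable Q (\<lambda>q. implicit_obj f g A B b q x) \<and>
         (\<lambda>x'. \<integral>q. implicit_obj f g A B b q x' \<partial>Q) differentiable (at x) \<and>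
         integrable Q (\<lambda>q. gradient (implicit_obj f g A B b q) x) \<and>
         gradient (\<lambda>x'. \<integral>q. implicit_obj f g A B b q x' \<partial>Q) x
           = (\<integral>q. gradient (implicit_obj f g A B b q) x \<partial>Q)) \<and>
    (\<forall>\<xi>\<in>space Df. \<forall>x. integrable Q (\<lambda>q. implicit_obj (ft \<xi>) g A B b q x) \<and>
         (\<lambda>x'. \<integral>q. implicit_obj (ft \<xi>) g A B b q x' \<partial>Q) differentiable (at x) \<and>
         integrable Q (\<lambda>q. gradient (implicit_obj (ft \<xi>) g A B b q) x) \<and>
         gradient (\<lambda>x'. \<integral>q. implicit_obj (ft \<xi>) g A B b q x' \<partial>Q) x
           = (\<integral>q. gradient (implicit_obj (ft \<xi>) g A B b q) x \<partial>Q)) \<and>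
    (\<forall>x. AE q in Q.
       (let y = ystar g A B b q x;
            Jy = jacobian (ystar g A B b q) (at x);
            Jlam = jacobian (lambda_bar g A B b q) (at x);
            I = active A B b x y;
            Abar = row_part I A;
            Bbar = row_part I B;
            Hinv = matrix_inv (hess_yy g x y)
        in implicit_obj f g A B b q differentiable (at x) \<and>
           gradient (implicit_obj f g A B b q) x
             = grad_x f x y + transpose Jy *v grad_y f x y \<and>
           (\<forall>\<xi>\<in>space Df.
              implicit_obj (ft \<xi>) g A B b q differentiable (at x) \<and>
              gradient (implicit_obj (ft \<xi>) g A B b q) x
                = grad_x (ft \<xi>) x y + transpose Jy *v grad_y (ft \<xi>) x y) \<and>
           ystar g A B b q differentiable (at x) \<and>
           Jy = Hinv ** (- hess_xy g x y - transpose Abar ** Jlam) \<and>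
           lambda_bar g A B b q differentiable (at x) \<and>
           Jlam = - block_inv I (Abar ** Hinv ** transpose Abar)
                  ** (Abar ** Hinv ** hess_xy g x y - Bbar)))"
proof -
  interpret lower_level g A B b \<mu>
    using g_C2 compact_feasible mu_pos g_strongly_convex slater full_row_rank
    by unfold_locales (simp_all add: Let_def)
  have strict: "AE q in Q. \<forall>i\<in>active A B b x (ystar g A B b q x). lambda_bar g A B b q x $ i > 0" for x
    by (rule absolutely_continuous_AE[OF _ Q(3) strict_complementarity_lborel]) (simp add: Q(2))
  have diff: "AE q in Q. implicit_obj h g A B b q differentiable (at x)" if "cont_diff h" for h x
    using strict[of x]
  proof eventually_elim
    case (elim q)
    then have "GDERIV (implicit_obj h g A B b q) x :> gradient (implicit_obj h g A B b q) x"
      using GDERIV_implicit_obj[OF that sol_lambda_bar_derivative(2)] gradient_eqI by metis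
    then show ?case unfolding gderiv_def by (rule differentiableI)
  qed
  note expected = expected_implicit_obj[OF _ Q(1,2) diff]
  show ?thesis
  proof (intro conjI allI ballI)
    fix x
    show "AE q in Q.
       (let y = ystar g A B b q x;
            Jy = jacobian (ystar g A B b q) (at x);
            Jlam = jacobian (lambda_bar g A B b q) (at x);
            I = active A B b x y;
            Abar = row_part I A;
            Bbar = row_part I B;
            Hinv = matrix_inv (hess_yy g x y)
        in implicit_obj f g A B b q differentiable (at x) \<and>
           gradient (implicit_obj f g A B b q) x
             = grad_x f x y + transpose Jy *v grad_y f x y \<and>
           (\<forall>\<xi>\<in>space Df.
              implicit_obj (ft \<xi>) g A B b q differentiable (at x) \<and>
              gradient (implicit_obj (ft \<xi>) g A B b q) x
                = grad_x (ft \<xi>) x y + transpose Jy *v grad_y (ft \<xi>) x y) \<and>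
           ystar g A B b q differentiable (at x) \<and>
           Jy = Hinv ** (- hess_xy g x y - transpose Abar ** Jlam) \<and>
           lambda_bar g A B b q differentiable (at x) \<and>
           Jlam = - block_inv I (Abar ** Hinv ** transpose Abar)
                  ** (Abar ** Hinv ** hess_xy g x y - Bbar))"
      using strict[of x]
    proof eventually_elim
      case (elim q)
      then have pos: "\<And>i. i \<in> active A B b x (ystar g A B b q x) \<Longrightarrow> lambda_bar g A B b q x $ i > 0"
        by blast
      let ?I = "active A B b x (ystar g A B b q x)" and ?y = "ystar g A B b q x"
      let ?A = "row_part ?I A" and ?Hinv = "matrix_inv (hess_yy g x ?y)"
      let ?Jlam = "- block_inv ?I (?A ** ?Hinv ** transpose ?A)
        ** (?A ** ?Hinv ** hess_xy g x ?y - row_part ?I B)"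
      have lam: "(lambda_bar g A B b q has_derivative (\<lambda>v. ?Jlam *v v)) (at x)"
        by (rule sol_lambda_bar_derivative(1)) (rule pos)
      have sol: "(ystar g A B b q has_derivative
          (\<lambda>v. (?Hinv ** (- hess_xy g x ?y - transpose ?A ** ?Jlam)) *v v)) (at x)"
        by (rule sol_lambda_bar_derivative(2)) (rule pos)
      note Jlam = jacobian_eqI[OF lam]
      note Jy = jacobian_eqI[OF sol]
      have obj: "implicit_obj h g A B b q differentiable (at x)"
        "gradient (implicit_obj h g A B b q) x
          = grad_x h x (ystar g A B b q x)
            + transpose (jacobian (ystar g A B b q) (at x)) *v grad_y h x (ystar g A B b q x)"
        if "cont_diff h" for h
      proof -
        have grad: "GDERIV (implicit_obj h g A B b q) x :>
            grad_x h x (ystar g A B b q x)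
              + transpose (jacobian (ystar g A B b q) (at x)) *v grad_y h x (ystar g A B b q x)"
          unfolding Jy by (rule GDERIV_implicit_obj[OF that sol])
        then show "implicit_obj h g A B b q differentiable (at x)"
          unfolding gderiv_def by (rule differentiableI)
        show "gradient (implicit_obj h g A B b q) x
          = grad_x h x (ystar g A B b q x)
            + transpose (jacobian (ystar g A B b q) (at x)) *v grad_y h x (ystar g A B b q x)"
          by (rule gradient_eqI[OF grad])
      qed
      show ?case
        unfolding Let_def
        by (intro conjI ballI obj f_C1 ft_C1 differentiableI[OF lam] differentiableI[OF sol] Jlam)
          (assumption | simp only: Jy Jlam)+
    qed
  qed (intro expected f_C1 ft_C1; assumption)+
qed

end
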